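(* Let $\hat{A}\in\mathbb{DC}_n^{\mathrm{CM}}$ with $r=\operatorname{Rank}(\hat{A})$. Then there exist $\hat{U}\in\mathbb{DC}_n^{U}$, matrices $K_1,K_2\in\mathbb{C}^{r\times r}$ with $K_1$ invertible and $L_1,L_2\in\mathbb{C}^{r\times(n-r)}$ satisfying $$K_1K_1^*+L_1L_1^*=I_r,\qquad K_1K_2^*+K_2K_1^*+L_1L_2^*+L_2L_1^*=0,$$ and $\Sigma_1=\Sigma_{1s}+\epsilon\Sigma_{1d}=\operatorname{diag}(\mu_1,\ldots,\mu_r)$ with $\mu_1\ge\cdots\ge\mu_r$ positive appreciable dual numbers, such that $\hat A=\hat U\begin{bmatrix}\Sigma_1(K_1+\epsilon K_2)&\Sigma_1(L_1+\epsilon L_2)\\0&0\end{bmatrix}\hat U^*$ and $$\hat{A}^{\#}=\hat{U}\left(\begin{bmatrix}K_1^{-1}\Sigma_1^{-1}&K_1^{-1}\Sigma_1^{-1}K_1^{-1}L_1\\0&0\end{bmatrix}+\epsilon\begin{bmatrix}-K_1^{-1}K_2K_1^{-1}\Sigma_1^{-1}&R+K_1^{-1}\Sigma_{1s}^{-2}\Sigma_{1d}K_1^{-1}L_1\\0&0\end{bmatrix}\right)\hat{U}^*$$ $$=\hat{U}\left(\begin{bmatrix}K_1^{-1}\Sigma_{1s}^{-1}&K_1^{-1}\Sigma_{1s}^{-1}K_1^{-1}L_1\\0&0\end{bmatrix}+\epsilon\begin{bmatrix}-K_1^{-1}K_2K_1^{-1}\Sigma_{1s}^{-1}-K_1^{-1}\Sigma_{1s}^{-2}\Sigma_{1d}&R\\0&0\end{bmatrix}\right)\hat{U}^*,$$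 where $$R=K_1^{-1}\Sigma_{1s}^{-1}K_1^{-1}L_2-K_1^{-1}\left(\Sigma_{1s}^{-1}K_1^{-1}K_2+K_2K_1^{-1}\Sigma_{1s}^{-1}\right)K_1^{-1}L_1-K_1^{-1}\Sigma_{1s}^{-2}\Sigma_{1d}K_1^{-1}L_1.$$
   Context: Dual complex numbers are $\hat a=a_s+\epsilon a_d$ with $a_s,a_d\in\mathbb{C}$, $\epsilon\ne0$, $\epsilon^2=0$, $\epsilon$ commuting with scalars; they form the ring $\mathbb{DC}$. A dual number is such an element with $a_s,a_d\in\mathbb{R}$. It is appreciable if $a_s\neq0$ and infinitesimal if $a_s=0$. Dual numbers are totally ordered by: $\hat a\le\hat b$ iff $a_s<b_s$, or $a_s=b_s$ and $a_d\le b_d$; $\hat a$ is positive if $\hat a>0$. A matrix $\hat A\in\mathbb{DC}^{m\times n}$ is written $\hat A=A_s+\epsilon A_d$ with $A_s,A_d\in\mathbb{C}^{m\times n}$; $\hat A^*=A_s^*+\epsilon A_d^*$. $\mathbb{DC}_n^U$ is the set of $\hat U\in\mathbb{DC}^{n\times n}$ with $\hat U^{-1}=\hat U^*$. $\Sigma_{1s},\Sigma_{1d}$ are the standard and infinitesimal parts of $\Sigma_1$. Dual SVD: every $\hat A\in\mathbb{DC}^{m\times n}$ can be written $\hat A=\hat P\begin{bmatrix}\Sigma_0&0\\0&0\end{bmatrix}\hat V^*$ with $\hat P\in\mathbb{DC}_m^U$, $\hat V\in\mathbb{DC}_n^U$, $\Sigma_0=\operatorname{diag}(\mu_1,\ldots,\mu_t)$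 with positive dual number entries in nonincreasing order (appreciable ones first, then infinitesimal ones), where $\Sigma_0$ is uniquely determined by $\hat A$; $\operatorname{Rank}(\hat A)=t$. $\mathbb{DC}_n^{\mathrm{CM}}=\{\hat A\in\mathbb{DC}^{n\times n}:\mathcal R(\hat A^2)=\mathcal R(\hat A)\}$, where $\mathcal R(\hat A)=\{\hat Ax:x\in\mathbb{DC}^n\}$. For $\hat A\in\mathbb{DC}_n^{\mathrm{CM}}$ the dual group inverse (DGGI) $\hat A^{\#}$ is the unique $\hat X$ with $\hat A\hat X\hat A=\hat A$, $\hat X\hat A\hat X=\hat X$, $\hat A\hat X=\hat X\hat A$. *)

theory Defs
  imports "Jordan_Normal_Form.Schur_Decomposition"
begin

section \<open>Dual numbers\<close>

text \<open>
  \<open>Dual a b\<close> stands for $a + \epsilon b$ with $\epsilon^2 = 0$. The ring of dual complex numbers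
  is \<open>complex dual\<close>, and the dual numbers are \<open>real dual\<close>.
\<close>

datatype 'a dual = Dual (std_part: 'a) (inf_part: 'a)

instantiation dual :: (comm_ring_1) comm_ring_1
begin

definition "0 = Dual 0 0"
definition "1 = Dual 1 0"
definition "a + b = Dual (std_part a + std_part b) (inf_part a + inf_part b)"
definition "a - b = Dual (std_part a - std_part b) (inf_part a - inf_part b)"
definition "- a = Dual (- std_part a) (- inf_part a)"
definition "a * b =
  Dual (std_part a * std_part b) (std_part a * inf_part b + inf_part a * std_part b)"

instance
  by standard
    (auto simp: zero_dual_def one_dual_def plus_dual_def minus_dual_def uminus_dual_def
      times_dual_def algebra_simps intro: dual.expand)

end

instantiation dual :: (linorder) linorder
begin

definition "a \<le> b \<longleftrightarrow>
  std_part a < std_part b \<or> (std_part a = std_part b \<and> inf_part a \<le> inf_part b)"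
definition "a < (b :: 'a dual) \<longleftrightarrow> a \<le> b \<and> \<not> b \<le> a"

instance
  by standard (auto simp: less_eq_dual_def less_dual_def intro: dual.expand)

end

definition appreciable :: "'a::zero dual \<Rightarrow> bool" where
  "appreciable a \<longleftrightarrow> std_part a \<noteq> 0"

definition eps :: "complex dual" where
  "eps = Dual 0 1"

definition dual_of_complex :: "complex \<Rightarrow> complex dual" where
  "dual_of_complex z = Dual z 0"

definition dual_complex_of_dual :: "real dual \<Rightarrow> complex dual" where
  "dual_complex_of_dual = map_dual complex_of_real"

section \<open>Dual complex matrices\<close>

definition lift_mat :: "complex mat \<Rightarrow> complex dual mat" where
  "lift_mat = map_mat dual_of_complex"

definition std_mat :: "complex dual mat \<Rightarrow> complex mat" where
  "std_mat = map_mat std_part"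

definition inf_mat :: "complex dual mat \<Rightarrow> complex mat" where
  "inf_mat = map_mat inf_part"

definition dual_mat :: "complex mat \<Rightarrow> complex mat \<Rightarrow> complex dual mat" where
  "dual_mat As Ad = lift_mat As + eps \<cdot>\<^sub>m lift_mat Ad"

definition dual_adjoint :: "complex dual mat \<Rightarrow> complex dual mat" where
  "dual_adjoint A = dual_mat (mat_adjoint (std_mat A)) (mat_adjoint (inf_mat A))"

definition dual_diag :: "nat \<Rightarrow> (nat \<Rightarrow> real dual) \<Rightarrow> complex dual mat" where
  "dual_diag t \<mu> = mat_diag t (\<lambda>i. dual_complex_of_dual (\<mu> i))"

text \<open>The two-sided inverse of an invertible square matrix.\<close>

definition mat_inv :: "'a::semiring_1 mat \<Rightarrow> 'a mat" where
  "mat_inv A = (THE B. B \<in> carrier_mat (dim_row A) (dim_row A) \<and> inverts_mat A B \<and> inverts_mat B A)"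

lemma mat_inv_eqI:
  assumes A: "A \<in> carrier_mat n n" and B: "B \<in> carrier_mat n n"
    and AB: "A * B = 1\<^sub>m n" and BA: "B * A = 1\<^sub>m n"
  shows "mat_inv A = B"
  unfolding mat_inv_def
proof (rule the_equality)
  show "B \<in> carrier_mat (dim_row A) (dim_row A) \<and> inverts_mat A B \<and> inverts_mat B A"
    using assms by (auto simp: inverts_mat_def)
next
  fix C assume "C \<in> carrier_mat (dim_row A) (dim_row A) \<and> inverts_mat A C \<and> inverts_mat C A"
  with A have C: "C \<in> carrier_mat n n" and CA: "C * A = 1\<^sub>m n"
    by (auto simp: inverts_mat_def)
  have "C = C * (A * B)" using C AB by simp
  also have "\<dots> = C * A * B" using A B C by (simp add: assoc_mult_mat)
  also have "\<dots> = B" using CA B by simp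
  finally show "C = B" .
qed

definition dual_unitary :: "nat \<Rightarrow> complex dual mat set" where
  "dual_unitary n = {U \<in> carrier_mat n n. invertible_mat U \<and> mat_inv U = dual_adjoint U}"

text \<open>
  The block matrix with first block row \<open>X Y\<close>, padded by zero rows to \<open>m\<close> rows.
\<close>

definition top_blocks :: "nat \<Rightarrow> 'a::zero mat \<Rightarrow> 'a mat \<Rightarrow> 'a mat" where
  "top_blocks m X Y = four_block_mat X Y
     (0\<^sub>m (m - dim_row X) (dim_col X)) (0\<^sub>m (m - dim_row X) (dim_col Y))"

section \<open>Dual singular values and rank\<close>

text \<open>
  In the lexicographic order every positive appreciable dual number exceeds every infinitesimal
  one, so monotonicity of \<open>\<mu>\<close> already puts the appreciable entries first.
\<close>

definition is_dual_svd ::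
  "complex dual mat \<Rightarrow> complex dual mat \<Rightarrow> nat \<Rightarrow> (nat \<Rightarrow> real dual) \<Rightarrow> complex dual mat \<Rightarrow> bool"
where
  "is_dual_svd A P t \<mu> V \<longleftrightarrow>
     P \<in> dual_unitary (dim_row A) \<and> V \<in> dual_unitary (dim_col A) \<and>
     t \<le> dim_row A \<and> t \<le> dim_col A \<and>
     (\<forall>i<t. 0 < \<mu> i) \<and> (\<forall>i j. i \<le> j \<and> j < t \<longrightarrow> \<mu> j \<le> \<mu> i) \<and>
     A = P * top_blocks (dim_row A) (dual_diag t \<mu>) (0\<^sub>m t (dim_col A - t)) * dual_adjoint V"

definition dual_rank :: "complex dual mat \<Rightarrow> nat" where
  "dual_rank A = (THE t. \<exists>P \<mu> V. is_dual_svd A P t \<mu> V)"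

section \<open>Dual group inverse\<close>

definition dual_range :: "complex dual mat \<Rightarrow> complex dual vec set" where
  "dual_range A = (\<lambda>x. A *\<^sub>v x) ` carrier_vec (dim_col A)"

definition dual_CM :: "nat \<Rightarrow> complex dual mat set" where
  "dual_CM n = {A \<in> carrier_mat n n. dual_range (A * A) = dual_range A}"

definition is_DGGI :: "complex dual mat \<Rightarrow> complex dual mat \<Rightarrow> bool" where
  "is_DGGI A X \<longleftrightarrow> X \<in> carrier_mat (dim_row A) (dim_row A) \<and>
     A * X * A = A \<and> X * A * X = X \<and> A * X = X * A"

definition DGGI :: "complex dual mat \<Rightarrow> complex dual mat" where
  "DGGI A = (THE X. is_DGGI A X)"

lemma DGGI_eqI:
  assumes A: "A \<in> carrier_mat n n" and "is_DGGI A X"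
  shows "DGGI A = X"
  unfolding DGGI_def
proof (rule the_equality)
  show "is_DGGI A X" by fact
next
  fix Y assume "is_DGGI A Y"
  with assms have X: "X \<in> carrier_mat n n" and Y: "Y \<in> carrier_mat n n"
    and x: "A * X * A = A" "X * A * X = X" "A * X = X * A"
    and y: "A * Y * A = A" "Y * A * Y = Y" "A * Y = Y * A"
    by (auto simp: is_DGGI_def)
  note [simp] = assoc_mult_mat[of _ n n _ n _ n] mult_carrier_mat[of _ n n _ n]
  have e: "A * X = A * Y"
  proof -
    have "A * X = (A * Y * A) * X" using y by simp
    also have "\<dots> = (A * Y) * (A * X)" using A X Y by simp
    also have "\<dots> = (Y * A) * (X * A)" using x y by simp
    also have "\<dots> = Y * (A * X * A)" using A X Y by simp
    also have "\<dots> = A * Y" using x y by simp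
    finally show ?thesis .
  qed
  have "Y = Y * (A * Y)" using y A Y by simp
  also have "\<dots> = (Y * A) * X" using e[symmetric] A X Y by simp
  also have "\<dots> = (X * A) * X" using e x y by simp
  also have "\<dots> = X" using x by simp
  finally show "Y = X" .
qed

end

theory Submission
  imports Defs
begin

text \<open>
  Diagonalize the Hermitian matrix $A A^*$ by a unitary $U$ over the dual complex numbers. The rows of
  $B = U^* A U$ are then orthogonal; the first $r$ of them have appreciable norm $\mu_i$ and, after
  normalization, form the block row $[K\; L]$, while the others are infinitesimal. The range condition
  gives $B = B^2 W$, which makes the standard part of $K$ invertible and annihilates the remaining
  rows. Inverting the resulting block matrix explicitly gives the group inverse. Finally $r$ is the rank,
  because $\mathrm{tr}(A X)$ equals the number of singular values whenever $A X A = A$.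
\<close>

section \<open>Arithmetic of dual numbers\<close>

text \<open>The ring has zero divisors, and this shapes the argument. A row of \<open>B\<close>
  whose standard part vanishes has a squared norm divisible by \<open>eps * eps\<close>, that is,
  zero; so the spectrum of \<open>A * adj A\<close> cannot tell an infinitesimal singular value from
  a zero one. The range condition has to do it. In \<open>B = B * Y\<close> with
  \<open>Y = B * (adj U * W * U)\<close>, the lower rows of \<open>Y\<close> have no standard part,
  so a lower row of \<open>B\<close> is determined by its first r entries; orthogonality to the
  upper rows then makes these entries vanish. For the same reason the rank is no dimension count. It
  is a unique choice among all decompositions, and the trace serves because it does not refer to a
  decomposition and its values are told apart by their standard parts. The closed formula is a
  first-order expansion: the inverse of a + eps b is a^-1 - eps a^-1 b a^-1.\<close>

lemma std_part_simps [simp]: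
  "std_part 0 = 0" "std_part 1 = 1" "std_part (a + b) = std_part a + std_part b"
  "std_part (a - b) = std_part a - std_part b" "std_part (- a) = - std_part a"
  "std_part (a * b) = std_part a * std_part b"
  by (simp_all add: zero_dual_def one_dual_def plus_dual_def minus_dual_def uminus_dual_def
      times_dual_def)

lemma inf_part_simps [simp]:
  "inf_part 0 = 0" "inf_part 1 = 0" "inf_part (a + b) = inf_part a + inf_part b"
  "inf_part (a - b) = inf_part a - inf_part b" "inf_part (- a) = - inf_part a"
  "inf_part (a * b) = std_part a * inf_part b + inf_part a * std_part b"
  by (simp_all add: zero_dual_def one_dual_def plus_dual_def minus_dual_def uminus_dual_def
      times_dual_def)

lemma dual_eq_iff: "a = b \<longleftrightarrow> std_part a = std_part b \<and> inf_part a = inf_part b"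
  by (auto intro: dual.expand)

lemma std_part_sum [simp]: "std_part (sum f S) = (\<Sum>x\<in>S. std_part (f x))"
  by (induction S rule: infinite_finite_induct) auto

lemma inf_part_sum [simp]: "inf_part (sum f S) = (\<Sum>x\<in>S. inf_part (f x))"
  by (induction S rule: infinite_finite_induct) auto

lemma std_part_of_nat [simp]: "std_part (of_nat k) = of_nat k"
  by (induction k) auto

lemma eps_parts [simp]: "std_part eps = 0" "inf_part eps = 1"
  by (simp_all add: eps_def)

lemma dual_of_complex_parts [simp]:
  "std_part (dual_of_complex z) = z" "inf_part (dual_of_complex z) = 0"
  by (simp_all add: dual_of_complex_def)

lemma dual_complex_of_dual_parts [simp]:
  "std_part (dual_complex_of_dual x) = of_real (std_part x)"
  "inf_part (dual_complex_of_dual x) = of_real (inf_part x)"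
  by (simp_all add: dual_complex_of_dual_def dual.map_sel)

text \<open>Conjugation fixes \<open>eps\<close>, as in \<open>dual_adjoint\<close>. A nonzero
  element may have \<open>a * conjugate a = 0\<close>, namely every infinitesimal one.\<close>

instantiation dual :: ("{comm_ring_1, conjugatable_ring}") conjugatable_ring
begin

definition "conjugate a = Dual (conjugate (std_part a)) (conjugate (inf_part a))"

instance
  by standard (auto simp: dual_eq_iff conjugate_dual_def conjugate_dist_mul conjugate_dist_add
      conjugate_neg)

end

lemma conjugate_dual_parts [simp]:
  "std_part (conjugate a) = conjugate (std_part a)"
  "inf_part (conjugate a) = conjugate (inf_part a)"
  by (simp_all add: conjugate_dual_def)

section \<open>Adjoints and unitary matrices\<close>

text \<open>The adjoint of \<open>Schur_Decomposition\<close> requires a field, which dual numbers are not.\<close>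

definition adj :: "'a::conjugatable_ring mat \<Rightarrow> 'a mat" where
  "adj A = mat (dim_col A) (dim_row A) (\<lambda>(i,j). conjugate (A $$ (j,i)))"

lemma adj_dim [simp]: "dim_row (adj A) = dim_col A" "dim_col (adj A) = dim_row A"
  by (simp_all add: adj_def)

lemma adj_index [simp]:
  "i < dim_col A \<Longrightarrow> j < dim_row A \<Longrightarrow> adj A $$ (i,j) = conjugate (A $$ (j,i))"
  by (simp add: adj_def)

lemma adj_carrier [simp, intro]: "A \<in> carrier_mat n m \<Longrightarrow> adj A \<in> carrier_mat m n"
  by (rule carrier_matI) auto

lemma adj_adj [simp]: "adj (adj A) = A"
  by (rule eq_matI) simp_all

lemma index_mult_mat_sum:
  "A \<in> carrier_mat n m \<Longrightarrow> B \<in> carrier_mat m k \<Longrightarrow> i < n \<Longrightarrow> j < k \<Longrightarrow>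
    (A * B) $$ (i,j) = (\<Sum>l<m. A $$ (i,l) * B $$ (l,j))"
  by (auto simp: scalar_prod_def atLeast0LessThan)

lemma adj_mult:
  fixes A B :: "'a::{comm_ring,conjugatable_ring} mat"
  assumes A: "A \<in> carrier_mat n m" and B: "B \<in> carrier_mat m k"
  shows "adj (A * B) = adj B * adj A"
proof (rule eq_matI)
  fix i j assume "i < dim_row (adj B * adj A)" "j < dim_col (adj B * adj A)"
  with A B have i: "i < k" and j: "j < n" by auto
  have "adj (A * B) $$ (i,j) = conjugate ((A * B) $$ (j,i))" using A B i j by simp
  also have "\<dots> = (\<Sum>l<m. conjugate (A $$ (j,l) * B $$ (l,i)))"
    unfolding index_mult_mat_sum[OF A B j i] by (rule sum_conjugate) simp
  also have "\<dots> = (\<Sum>l<m. adj B $$ (i,l) * adj A $$ (l,j))"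
    using A B i j by (intro sum.cong refl) (simp add: conjugate_dist_mul mult.commute)
  also have "\<dots> = (adj B * adj A) $$ (i,j)"
    using index_mult_mat_sum[OF adj_carrier[OF B] adj_carrier[OF A] i j] by simp
  finally show "adj (A * B) $$ (i,j) = (adj B * adj A) $$ (i,j)" .
qed (use A B in auto)

lemma adj_mat_diag: "adj (mat_diag n f) = mat_diag n (\<lambda>i. conjugate (f i))"
  by (intro eq_matI) (auto simp: mat_diag_def)

lemma conjugate_one [simp]: "conjugate (1 :: 'a::{comm_ring_1,conjugatable_ring}) = 1"
  by (metis conjugate_dist_mul conjugate_id mult.right_neutral mult.left_neutral)

lemma adj_one [simp]: "adj (1\<^sub>m n :: 'a::{comm_ring_1,conjugatable_ring} mat) = 1\<^sub>m n"
  by (intro eq_matI) auto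

lemma mat_adjoint_eq_adj: "mat_adjoint A = adj A"
  by (intro eq_matI) (auto simp: mat_adjoint_def mat_of_rows_def)

text \<open>Expressed by the two products instead of \<open>mat_inv\<close>, so that complex and
  dual complex matrices share one notion; \<open>is_unitary_iff_dual_unitary\<close> links it to
  \<open>dual_unitary\<close>.\<close>

definition is_unitary :: "nat \<Rightarrow> 'a::{comm_ring_1,conjugatable_ring} mat \<Rightarrow> bool" where
  "is_unitary n U \<longleftrightarrow> U \<in> carrier_mat n n \<and> adj U * U = 1\<^sub>m n \<and> U * adj U = 1\<^sub>m n"

lemma is_unitaryD:
  assumes "is_unitary n U"
  shows "U \<in> carrier_mat n n" "adj U \<in> carrier_mat n n" "adj U * U = 1\<^sub>m n" "U * adj U = 1\<^sub>m n"
  using assms by (auto simp: is_unitary_def)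

lemma is_unitary_adj: "is_unitary n U \<Longrightarrow> is_unitary n (adj U)"
  by (auto simp: is_unitary_def)

lemma mult_cancel_middle:
  fixes A :: "'a::semiring_1 mat"
  assumes "A \<in> carrier_mat k n" "B \<in> carrier_mat n n" "C \<in> carrier_mat n n" "D \<in> carrier_mat n m"
    "B * C = 1\<^sub>m n"
  shows "A * B * (C * D) = A * D"
proof -
  have "A * B * (C * D) = A * (B * C * D)"
    using assms(1-4) by (simp add: assoc_mult_mat[of _ k n _ n _ m] assoc_mult_mat[of _ n n _ n _ m])
  then show ?thesis using assms by simp
qed

lemma is_unitary_mult:
  assumes "is_unitary n U" "is_unitary n V"
  shows "is_unitary n (U * V)"
proof -
  note u = is_unitaryD[OF assms(1)] and v = is_unitaryD[OF assms(2)]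
  have "adj (U * V) * (U * V) = 1\<^sub>m n"
    unfolding adj_mult[OF u(1) v(1)] using mult_cancel_middle[OF v(2) u(2) u(1) v(1) u(3)] v by simp
  moreover have "(U * V) * adj (U * V) = 1\<^sub>m n"
    unfolding adj_mult[OF u(1) v(1)] using mult_cancel_middle[OF u(1) v(1) v(2) u(2) v(4)] u by simp
  ultimately show ?thesis
    unfolding is_unitary_def using mult_carrier_mat[OF u(1) v(1)] by blast
qed

lemma is_unitaryI_field:
  fixes U :: "'a::{field,conjugatable_ring} mat"
  assumes "U \<in> carrier_mat n n" "adj U * U = 1\<^sub>m n"
  shows "is_unitary n U"
  unfolding is_unitary_def
  using assms mat_mult_left_right_inverse[OF adj_carrier[OF assms(1)] assms(1,2)] by blast

lemma is_unitary_block: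
  assumes "is_unitary n U" "is_unitary m V"
  shows "is_unitary (n + m) (four_block_mat U (0\<^sub>m n m) (0\<^sub>m m n) V)" (is "is_unitary _ ?W")
proof -
  note u = is_unitaryD[OF assms(1)] and v = is_unitaryD[OF assms(2)]
  have a: "adj ?W = four_block_mat (adj U) (0\<^sub>m n m) (0\<^sub>m m n) (adj V)"
    using u(1) v(1) by (intro eq_matI) auto
  have one: "four_block_mat (1\<^sub>m n) (0\<^sub>m n m) (0\<^sub>m m n) (1\<^sub>m m) = (1\<^sub>m (n + m) :: 'a mat)"
    by (rule four_block_one_mat)
  have "adj ?W * ?W = 1\<^sub>m (n + m)"
    unfolding a mult_four_block_mat[OF u(2) zero_carrier_mat zero_carrier_mat v(2)
        u(1) zero_carrier_mat zero_carrier_mat v(1)]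
    using u v one by simp
  moreover have "?W * adj ?W = 1\<^sub>m (n + m)"
    unfolding a mult_four_block_mat[OF u(1) zero_carrier_mat zero_carrier_mat v(1)
        u(2) zero_carrier_mat zero_carrier_mat v(2)]
    using u v one by simp
  ultimately show ?thesis
    unfolding is_unitary_def using four_block_carrier_mat[OF u(1) v(1)] by blast
qed

lemma unitary_similar_eq:
  assumes U: "is_unitary n U" and A: "A \<in> carrier_mat n n" and e: "adj U * A * U = B"
  shows "A = U * B * adj U"
proof -
  note u = is_unitaryD[OF U]
  have "U * B * adj U = (U * adj U) * A * (U * adj U)"
    unfolding e[symmetric] using u(1,2) A 
    by (simp add: assoc_mult_mat[of _ n n _ n _ n] mult_carrier_mat[of _ n n _ n])
  then show ?thesis using u A by simp
qed

lemma neg_mat_add: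
  fixes P Q :: "'a::ab_group_add mat"
  assumes "P \<in> carrier_mat n m" "Q \<in> carrier_mat n m"
  shows "- P + - Q = - Q - P" "- P + (Q + P) = Q"
  using assms by (auto intro!: eq_matI)

lemma sum_split_shift:
  fixes f :: "nat \<Rightarrow> 'a::comm_monoid_add"
  assumes "k \<le> n"
  shows "(\<Sum>l<n. f l) = (\<Sum>l<k. f l) + (\<Sum>l<n - k. f (l + k))"
proof -
  have "(\<Sum>l<k + m. f l) = (\<Sum>l<k. f l) + (\<Sum>l<m. f (l + k))" for m
    by (induction m) (simp_all add: add_ac)
  from this[of "n - k"] show ?thesis using assms by simp
qed

section \<open>The spectral theorem for complex Hermitian matrices\<close>

text \<open>Each column stays a multiple of the given vector, so an eigenvector at the head of the
  list survives, up to a scalar, as the first column.\<close>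

lemma corthogonal_normalize:
  fixes ws :: "complex vec list"
  assumes ws: "set ws \<subseteq> carrier_vec n" "corthogonal ws" "length ws = n"
  shows "\<exists>W c. is_unitary n W \<and> (\<forall>j<n. col W j = c j \<cdot>\<^sub>v ws ! j)"
proof -
  define c where "c j = complex_of_real (1 / sqrt (Re (ws ! j \<bullet>c ws ! j)))" for j
  define W where "W = mat_of_cols n (map (\<lambda>j. c j \<cdot>\<^sub>v ws ! j) [0..<n])"
  have W: "W \<in> carrier_mat n n" unfolding W_def using ws(3) by auto
  have wc: "ws ! j \<in> carrier_vec n" if "j < n" for j using ws that by (simp add: subset_code(1))
  have col: "col W j = c j \<cdot>\<^sub>v ws ! j" if "j < n" for j
    unfolding W_def using wc[OF that] that by (subst col_mat_of_cols) auto
  have ent: "W $$ (i,j) = c j * ws ! j $ i" if "i < n" "j < n" for i j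
    using col[OF that(2)] that W wc[OF that(2)]
    by (metis carrier_matD carrier_vecD index_col index_smult_vec(1))
  have "adj W * W = 1\<^sub>m n"
  proof (rule eq_matI)
    fix i j assume "i < dim_row (1\<^sub>m n :: complex mat)" "j < dim_col (1\<^sub>m n :: complex mat)"
    then have i: "i < n" and j: "j < n" by auto
    have "(adj W * W) $$ (i,j) = (\<Sum>l<n. adj W $$ (i,l) * W $$ (l,j))"
      by (rule index_mult_mat_sum[OF adj_carrier[OF W] W i j])
    also have "\<dots> = (\<Sum>l<n. cnj (c i) * c j * (ws ! j $ l * cnj (ws ! i $ l)))"
      using W i j by (intro sum.cong refl) (simp add: ent)
    also have "\<dots> = cnj (c i) * c j * (ws ! j \<bullet>c ws ! i)"
      unfolding sum_distrib_left[symmetric] using wc[OF i]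
      by (simp add: scalar_prod_def atLeast0LessThan)
    also have "\<dots> = 1\<^sub>m n $$ (i,j)"
    proof (cases "i = j")
      case False
      then show ?thesis using corthogonalD[OF ws(2), of j i] ws(3) i j by simp
    next
      case True
      have "ws ! j \<bullet>c ws ! j = (\<Sum>l<n. ws ! j $ l * cnj (ws ! j $ l))"
        using wc[OF j] by (simp add: scalar_prod_def atLeast0LessThan)
      also have "\<dots> = complex_of_real (\<Sum>l<n. (cmod (ws ! j $ l))\<^sup>2)"
        by (simp add: complex_norm_square[symmetric])
      finally obtain s where s: "ws ! j \<bullet>c ws ! j = complex_of_real s" "s \<ge> 0"
        by (meson sum_nonneg zero_le_power2)
      moreover have "ws ! j \<bullet>c ws ! j \<noteq> 0"
        using corthogonalD[OF ws(2), of j j] ws(3) j by simp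
      ultimately have "s > 0" by (cases "s = 0") auto
      then have "cnj (c j) * c j * (ws ! j \<bullet>c ws ! j) = complex_of_real (1 / sqrt s * (1 / sqrt s) * s)"
        unfolding c_def s
        by (simp only: Re_complex_of_real complex_cnj_complex_of_real of_real_mult)
      also have "1 / sqrt s * (1 / sqrt s) * s = 1" using \<open>s > 0\<close> by (simp add: field_simps)
      finally show ?thesis using True j by simp
    qed
    finally show "(adj W * W) $$ (i,j) = 1\<^sub>m n $$ (i,j)" .
  qed (use W in auto)
  with W have "is_unitary n W" by (rule is_unitaryI_field)
  with col show ?thesis by blast
qed

text \<open>Gram-Schmidt does not change the head of its input list, so completing \<open>v\<close>
  to a basis that starts with \<open>v\<close> and orthogonalizing keeps its direction.\<close>

lemma unitary_with_first_col:
  fixes v :: "complex vec"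
  assumes v: "v \<in> carrier_vec n" "v \<noteq> 0\<^sub>v n"
  obtains W c where "is_unitary n W" "col W 0 = c \<cdot>\<^sub>v v"
proof -
  interpret cof_vec_space n "TYPE(complex)" .
  define b where "b = basis_completion v"
  define ws where "ws = gram_schmidt n b"
  note bc = basis_completion[OF v, folded b_def]
  from v have n: "n \<noteq> 0" by auto
  from bc(6,7) n obtain vs where bv: "b = v # vs" by (cases b) auto
  from gram_schmidt_result[OF bc(2,4,5) refl, folded ws_def]
  have ws: "set ws \<subseteq> carrier_vec n" "corthogonal ws" "length ws = n" by (auto simp: bc(6))
  from gram_schmidt_hd[OF v(1), of vs, folded bv] have hd: "hd ws = v" unfolding ws_def .
  obtain W c where W: "is_unitary n W" and c: "\<forall>j<n. col W j = c j \<cdot>\<^sub>v ws ! j"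
    using corthogonal_normalize[OF ws] by blast
  have "ws ! 0 = v" using hd ws(3) n by (cases ws) auto
  with c n have "col W 0 = c 0 \<cdot>\<^sub>v v" by simp
  with W that show ?thesis by blast
qed

lemma hermitian_unitary_similar:
  assumes "is_unitary n U" "A \<in> carrier_mat n n" "adj A = A"
  shows "adj (adj U * A * U) = adj U * A * U"
proof -
  note u = is_unitaryD[OF assms(1)]
  have "adj (adj U * A * U) = adj U * (adj A * U)"
    using adj_mult[OF mult_carrier_mat[OF u(2) assms(2)] u(1)] adj_mult[OF u(2) assms(2)] by simp
  then show ?thesis using assoc_mult_mat[OF u(2) assms(2) u(1)] assms(3) by simp
qed

lemma unitary_similar_mult:
  fixes A :: "'a::{comm_ring_1,conjugatable_ring} mat"
  assumes U: "U \<in> carrier_mat n n" and V: "V \<in> carrier_mat n n" and A: "A \<in> carrier_mat n n"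
  shows "adj (U * V) * A * (U * V) = adj V * (adj U * A * U) * V"
proof -
  note au = adj_carrier[OF U] and av = adj_carrier[OF V]
  note ua = mult_carrier_mat[OF au A]
  have "adj (U * V) * A * (U * V) = adj V * (adj U * A) * (U * V)"
    unfolding adj_mult[OF U V] assoc_mult_mat[OF av au A] ..
  also have "\<dots> = adj V * (adj U * A) * U * V"
    by (rule assoc_mult_mat[OF mult_carrier_mat[OF av ua] U V, symmetric])
  also have "\<dots> = adj V * (adj U * A * U) * V"
    unfolding assoc_mult_mat[OF av ua U] ..
  finally show ?thesis .
qed

text \<open>Deflation. With an eigenvector for the head of the list as first column, the entries
  below the corner vanish; hermiticity then clears the entries to its right, and cancelling one
  linear factor leaves the tail of the list for the remaining block.\<close>

lemma hermitian_diagonalization: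
  fixes A :: "complex mat"
  assumes "A \<in> carrier_mat n n" "adj A = A" "char_poly A = (\<Prod>e\<leftarrow>es. [:- e, 1:])"
  shows "\<exists>U. is_unitary n U \<and> adj U * A * U = mat_diag n (\<lambda>i. es ! i)"
  using assms
proof (induction es arbitrary: n A)
  case Nil
  then have "n = 0" using degree_monic_char_poly[of A n] by simp
  then have "is_unitary n (1\<^sub>m n) \<and> adj (1\<^sub>m n) * A * 1\<^sub>m n = mat_diag n (\<lambda>i. [] ! i)"
    using Nil by (auto simp: is_unitary_def mat_diag_def intro!: eq_matI)
  then show ?case by blast
next
  case (Cons e es n A)
  note A = Cons.prems(1)
  have "poly (char_poly A) e = 0" unfolding Cons.prems(3) by simp
  then obtain v where ev: "eigenvector A v e"
    using eigenvalue_root_char_poly[OF A] unfolding eigenvalue_def by blast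
  then have v: "v \<in> carrier_vec n" "v \<noteq> 0\<^sub>v n" and Av: "A *\<^sub>v v = e \<cdot>\<^sub>v v"
    using A by (auto simp: eigenvector_def)
  from v obtain m where n: "n = Suc m" by (cases n) auto
  obtain W c where W: "is_unitary n W" and c: "col W 0 = c \<cdot>\<^sub>v v"
    by (rule unitary_with_first_col[OF v])
  note w = is_unitaryD[OF W]
  define B where "B = adj W * A * W"
  have B: "B \<in> carrier_mat n n" unfolding B_def by (rule mult_carrier_mat[OF mult_carrier_mat[OF w(2) A] w(1)])
  have "A *\<^sub>v col W 0 = e \<cdot>\<^sub>v col W 0"
    unfolding c using A v Av by (simp add: mult_mat_vec smult_smult_assoc mult.commute)
  then have AW: "col (A * W) 0 = e \<cdot>\<^sub>v col W 0" using col_mult2[OF A w(1), of 0] n by simp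
  have col0: "B $$ (i,0) = (if i = 0 then e else 0)" if i: "i < n" for i
  proof -
    have "B $$ (i,0) = row (adj W) i \<bullet> col (A * W) 0"
      unfolding B_def assoc_mult_mat[OF w(2) A w(1)] using A w(1) i n by simp
    also have "\<dots> = e * (row (adj W) i \<bullet> col W 0)"
      unfolding AW
      by (rule scalar_prod_smult_distrib[OF row_carrier_vec[OF i w(2)] col_carrier_vec[OF _ w(1)]])
        (simp add: n)
    also have "row (adj W) i \<bullet> col W 0 = (adj W * W) $$ (i,0)" using w(1,2) n i by simp
    finally show ?thesis using w(3) i n by simp
  qed
  have hB: "adj B = B"
    unfolding B_def by (rule hermitian_unitary_similar[OF W A Cons.prems(2)])
  have row0: "B $$ (0,i) = (if i = 0 then cnj e else 0)" if i: "i < n" for i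
  proof -
    have "B $$ (0,i) = adj B $$ (0,i)" using hB by simp
    also have "\<dots> = cnj (B $$ (i,0))" using B i n by simp
    finally show ?thesis using col0[OF i] by simp
  qed
  have "cnj e = e" using col0[of 0] row0[of 0] n by simp
  define C where "C = mat m m (\<lambda>(i,j). B $$ (Suc i, Suc j))"
  have C: "C \<in> carrier_mat m m" unfolding C_def by simp
  have hC: "adj C = C"
  proof (rule eq_matI)
    fix i j assume "i < dim_row C" "j < dim_col C"
    then have ij: "i < m" "j < m" using C by auto
    then have "adj C $$ (i,j) = adj B $$ (Suc i, Suc j)" using B n by (simp add: C_def)
    then show "adj C $$ (i,j) = C $$ (i,j)" using ij by (simp add: hB C_def)
  qed (use C in auto)
  define E where "E = mat 1 1 (\<lambda>_. e)"
  have E: "E \<in> carrier_mat 1 1" unfolding E_def by simp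
  have Bb: "B = four_block_mat E (0\<^sub>m 1 m) (0\<^sub>m m 1) C"
    using B n col0 row0 \<open>cnj e = e\<close> by (intro eq_matI) (auto simp: E_def C_def)
  have "similar_mat B A"
    unfolding similar_mat_def
    by (rule exI[of _ "adj W"], rule exI[of _ W])
      (rule similar_mat_witI[OF w(3,4) B_def B A w(2,1)])
  then have "char_poly B = char_poly A" by (rule char_poly_similar)
  moreover have "char_poly B = char_poly E * char_poly C"
    unfolding Bb by (rule char_poly_four_block_zeros_col[OF E _ C]) auto
  moreover have "char_poly E = [:- e, 1:]"
    by (simp add: E_def char_poly_defs det_def sign_def)
  ultimately have "[:- e, 1:] * char_poly C = [:- e, 1:] * (\<Prod>e\<leftarrow>es. [:- e, 1:])"
    using Cons.prems(3) by simp
  then have "char_poly C = (\<Prod>e\<leftarrow>es. [:- e, 1:])"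
    by (metis mult_cancel_left pCons_eq_0_iff zero_neq_one)
  from Cons.IH[OF C hC this] obtain V where V: "is_unitary m V"
    and VC: "adj V * C * V = mat_diag m (\<lambda>i. es ! i)" by blast
  note v' = is_unitaryD[OF V]
  define V' where "V' = four_block_mat (1\<^sub>m 1) (0\<^sub>m 1 m) (0\<^sub>m m 1) V"
  have "is_unitary 1 (1\<^sub>m 1 :: complex mat)" by (simp add: is_unitary_def)
  from is_unitary_block[OF this V] have V': "is_unitary n V'" unfolding V'_def n by simp
  note v'' = is_unitaryD[OF V']
  have aV': "adj V' = four_block_mat (1\<^sub>m 1) (0\<^sub>m 1 m) (0\<^sub>m m 1) (adj V)"
    unfolding V'_def using v'(1) by (intro eq_matI) auto
  have "adj V' * B * V' = four_block_mat E (0\<^sub>m 1 m) (0\<^sub>m m 1) (adj V * C * V)"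
  proof -
    have "adj V' * B = four_block_mat E (0\<^sub>m 1 m) (0\<^sub>m m 1) (adj V * C)"
      unfolding aV' Bb
      by (subst mult_four_block_mat[OF one_carrier_mat zero_carrier_mat zero_carrier_mat v'(2)
        E zero_carrier_mat zero_carrier_mat C]) (use E C v'(1,2) left_add_zero_mat[OF mult_carrier_mat[OF v'(2) C]] in simp)
    then show ?thesis
      unfolding V'_def
      by (simp only: , subst mult_four_block_mat[OF E zero_carrier_mat zero_carrier_mat
          mult_carrier_mat[OF v'(2) C] one_carrier_mat zero_carrier_mat zero_carrier_mat v'(1)])
        (use E C v'(1,2) mult_carrier_mat[OF v'(2) C] in simp)
  qed
  also have "\<dots> = mat_diag n (\<lambda>i. (e # es) ! i)"
    unfolding VC by (rule eq_matI) (auto simp: n E_def mat_diag_def nth_Cons')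
  finally have "adj V' * B * V' = mat_diag n (\<lambda>i. (e # es) ! i)" .
  moreover have "adj (W * V') * A * (W * V') = adj V' * B * V'"
    unfolding B_def using unitary_similar_mult[OF w(1) v''(1) A] .
  ultimately show ?case using is_unitary_mult[OF W V'] by auto
qed

text \<open>Schur's algorithm accepts the eigenvalues in any order, so they may be sorted beforehand.\<close>

theorem hermitian_spectral:
  fixes A :: "complex mat"
  assumes A: "A \<in> carrier_mat n n" "adj A = A"
  shows "\<exists>U (m :: nat \<Rightarrow> real). is_unitary n U \<and>
    adj U * A * U = mat_diag n (\<lambda>i. complex_of_real (m i)) \<and>
    (\<forall>i j. i \<le> j \<and> j < n \<longrightarrow> m j \<le> m i)"
proof -
  from char_poly_factorized[OF A(1)] obtain as
    where as: "char_poly A = (\<Prod>a\<leftarrow>as. [:- a, 1:])" "length as = n" by blast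
  \<comment> \<open>The eigenvalues are recognized as real only after the diagonalization, hence the
    sorting key \<open>Re\<close>; \<open>rev\<close> makes the order nonincreasing.\<close>
  define es where "es = rev (sort_key Re as)"
  have "mset es = mset as" unfolding es_def by simp
  then have len: "length es = n" and "mset (map (\<lambda>a. [:- a, 1:]) es) = mset (map (\<lambda>a. [:- a, 1:]) as)"
    using as(2) mset_eq_length[of es as] by simp_all
  then have "char_poly A = (\<Prod>a\<leftarrow>es. [:- a, 1:])"
    unfolding as by (metis prod_mset_prod_list)
  from hermitian_diagonalization[OF A this] obtain U where U: "is_unitary n U"
    and D: "adj U * A * U = mat_diag n (\<lambda>i. es ! i)" by blast
  have "adj (mat_diag n (\<lambda>i. es ! i)) = mat_diag n (\<lambda>i. es ! i)"
    using hermitian_unitary_similar[OF U A] unfolding D .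
  then have diag: "mat_diag n (\<lambda>i. cnj (es ! i)) $$ (i,i) = mat_diag n (\<lambda>i. es ! i) $$ (i,i)" for i
    unfolding adj_mat_diag by simp
  have real: "complex_of_real (Re (es ! i)) = es ! i" if "i < n" for i
    using that diag[of i] by (simp add: mat_diag_def complex_eq_iff)
  have "sorted (map Re (sort_key Re as))" by simp
  then have sorted: "Re (es ! j) \<le> Re (es ! i)" if "i \<le> j" "j < n" for i j
    using that len sorted_nth_mono[of "map Re (sort_key Re as)" "n - Suc j" "n - Suc i"]
    unfolding es_def by (simp add: rev_nth)
  have "adj U * A * U = mat_diag n (\<lambda>i. complex_of_real (Re (es ! i)))"
    unfolding D using real by (intro eq_matI) (auto simp: mat_diag_def)
  with U sorted show ?thesis by (intro exI[of _ U] exI[of _ "\<lambda>i. Re (es ! i)"]) simp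
qed

text \<open>
  Keep only the blocks of the second matrix inside the eigenspaces of the first, and add a multiple
  \<open>c\<close> of the first one so large that the spectra of the blocks are disjoint and ordered. A sorted
  diagonalization of the sum then respects the eigenspaces and sorts the pairs of eigenvalues
  lexicographically.
\<close>

lemma hermitian_pair_spectral:
  fixes H K :: "complex mat"
  assumes H: "H \<in> carrier_mat n n" "adj H = H" and K: "K \<in> carrier_mat n n" "adj K = K"
  shows "\<exists>Q (a :: nat \<Rightarrow> real) (d :: nat \<Rightarrow> real). is_unitary n Q \<and>
    adj Q * H * Q = mat_diag n (\<lambda>i. complex_of_real (a i)) \<and>
    (\<forall>i<n. \<forall>j<n. a i = a j \<longrightarrow>
      (adj Q * K * Q) $$ (i,j) = (if i = j then complex_of_real (d i) else 0)) \<and>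
    (\<forall>i j. i \<le> j \<and> j < n \<longrightarrow> Dual (a j) (d j) \<le> Dual (a i) (d i))"
proof -
  obtain Q1 and a0 :: "nat \<Rightarrow> real" where Q1: "is_unitary n Q1"
    and a0: "adj Q1 * H * Q1 = mat_diag n (\<lambda>i. complex_of_real (a0 i))"
    using hermitian_spectral[OF H] by blast
  note q = is_unitaryD[OF Q1]
  define G where "G = adj Q1 * K * Q1"
  have G: "G \<in> carrier_mat n n"
    unfolding G_def by (rule mult_carrier_mat[OF mult_carrier_mat[OF q(2) K(1)] q(1)])
  have hG: "adj G = G" unfolding G_def by (rule hermitian_unitary_similar[OF Q1 K])
  \<comment> \<open>This bounds every absolute row sum of \<open>G\<close>, and so the distance of
    an eigenvalue of the shifted block matrix from the shift of its block.\<close>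
  define B where "B = (\<Sum>i<n. \<Sum>k<n. cmod (G $$ (i,k)))"
  \<comment> \<open>Intervals of radius \<open>B\<close> around the points \<open>c * a0 i\<close>
    are disjoint for distinct values of \<open>a0\<close> once \<open>c\<close> is large; there are
    finitely many pairs, so one \<open>c\<close> serves them all.\<close>
  have "\<forall>\<^sub>F c in at_top. \<forall>i\<in>{..<n}. \<forall>j\<in>{..<n}. a0 j < a0 i \<longrightarrow> 2 * B < c * (a0 i - a0 j)"
  proof (intro eventually_ball_finite ballI finite_lessThan)
    fix i j
    show "\<forall>\<^sub>F c in at_top. a0 j < a0 i \<longrightarrow> 2 * B < c * (a0 i - a0 j)"
      using eventually_gt_at_top[of "2 * B / (a0 i - a0 j)"]
      by eventually_elim (auto simp: pos_divide_less_eq)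
  qed
  from eventually_happens'[OF trivial_limit_at_top_linorder this] obtain c where
    "\<forall>i\<in>{..<n}. \<forall>j\<in>{..<n}. a0 j < a0 i \<longrightarrow> 2 * B < c * (a0 i - a0 j)" ..
  then have gap: "2 * B < c * (a0 i - a0 j)" if "i < n" "j < n" "a0 j < a0 i" for i j
    using that by simp
  define D where "D i k = (if a0 i = a0 k then G $$ (i,k) else 0)" for i k
  define M where "M = mat n n (\<lambda>(i,k). D i k + (if i = k then complex_of_real (c * a0 i) else 0))"
  have M: "M \<in> carrier_mat n n" unfolding M_def by simp
  have hM: "adj M = M"
  proof (rule eq_matI)
    fix i j assume "i < dim_row M" "j < dim_col M"
    then have ij: "i < n" "j < n" using M by auto
    have "cnj (G $$ (j,i)) = adj G $$ (i,j)" using G ij by simp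
    then have "cnj (G $$ (j,i)) = G $$ (i,j)" unfolding hG .
    then show "adj M $$ (i,j) = M $$ (i,j)" using ij by (auto simp: M_def D_def)
  qed (use M in auto)
  obtain W and m :: "nat \<Rightarrow> real" where W: "is_unitary n W"
    and MW: "adj W * M * W = mat_diag n (\<lambda>i. complex_of_real (m i))"
    and m: "\<And>i j. i \<le> j \<Longrightarrow> j < n \<Longrightarrow> m j \<le> m i"
    using hermitian_spectral[OF M hM] by blast
  note w = is_unitaryD[OF W]
  have "M * W = W * (adj W * M * W)"
  proof -
    have "W * (adj W * M * W) = W * (adj W * (M * W))"
      unfolding assoc_mult_mat[OF w(2) M w(1)] ..
    also have "\<dots> = W * adj W * (M * W)"
      by (rule assoc_mult_mat[OF w(1,2) mult_carrier_mat[OF M w(1)], symmetric])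
    finally show ?thesis unfolding w(4) left_mult_one_mat[OF mult_carrier_mat[OF M w(1)]] ..
  qed
  then have ev: "(M * W) $$ (i,j) = complex_of_real (m j) * W $$ (i,j)" if "i < n" "j < n" for i j
    unfolding MW mat_diag_mult_right[OF w(1)] using that by simp
  have D: "(\<Sum>k<n. D i k * W $$ (k,j)) = complex_of_real (m j - c * a0 i) * W $$ (i,j)"
    if ij: "i < n" "j < n" for i j
  proof -
    have "complex_of_real (m j) * W $$ (i,j) = (\<Sum>k<n. M $$ (i,k) * W $$ (k,j))"
      using ev[OF ij] index_mult_mat_sum[OF M w(1) ij] by simp
    also have "\<dots> = (\<Sum>k<n. D i k * W $$ (k,j) +
        (if i = k then complex_of_real (c * a0 i) * W $$ (k,j) else 0))"
      using ij by (intro sum.cong refl) (simp add: M_def distrib_right)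
    also have "\<dots> = (\<Sum>k<n. D i k * W $$ (k,j)) + complex_of_real (c * a0 i) * W $$ (i,j)"
      using ij by (simp add: sum.distrib sum.delta)
    finally show ?thesis by (simp add: algebra_simps)
  qed
  \<comment> \<open>A Gershgorin estimate inside the class \<open>S\<close> of indices with the same
    \<open>a0\<close> as \<open>i\<close>. Since \<open>D\<close> couples no two classes, the row
    \<open>p\<close> in which column \<open>j\<close> is largest on \<open>S\<close> gives the
    bound; the nonzero entry makes that maximum positive.\<close>
  have near: "\<bar>m j - c * a0 i\<bar> \<le> B" if ij: "i < n" "j < n" and nz: "W $$ (i,j) \<noteq> 0" for i j
  proof -
    define S where "S = {k. k < n \<and> a0 k = a0 i}"
    have S: "finite S" "i \<in> S" using ij by (auto simp: S_def)
    have "Max ((\<lambda>k. cmod (W $$ (k,j))) ` S) \<in> (\<lambda>k. cmod (W $$ (k,j))) ` S"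
      using S by (intro Max_in) auto
    then obtain p where p: "p \<in> S" and pM: "Max ((\<lambda>k. cmod (W $$ (k,j))) ` S) = cmod (W $$ (p,j))"
      by (rule imageE)
    have pmax: "cmod (W $$ (k,j)) \<le> cmod (W $$ (p,j))" if "k \<in> S" for k
      unfolding pM[symmetric] using S(1) that by (intro Max_ge) auto
    from p have pn: "p < n" and ap: "a0 p = a0 i" by (auto simp: S_def)
    have pos: "0 < cmod (W $$ (p,j))" using pmax[OF S(2)] nz by (meson less_le_trans zero_less_norm_iff)
    have "\<bar>m j - c * a0 p\<bar> * cmod (W $$ (p,j)) = cmod (\<Sum>k<n. D p k * W $$ (k,j))"
      unfolding D[OF pn ij(2)] norm_mult norm_of_real ..
    also have "\<dots> \<le> (\<Sum>k<n. cmod (D p k * W $$ (k,j)))" by (rule norm_sum)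
    also have "\<dots> \<le> (\<Sum>k<n. cmod (G $$ (p,k)) * cmod (W $$ (p,j)))"
    proof (intro sum_mono)
      fix k assume "k \<in> {..<n}"
      then show "cmod (D p k * W $$ (k,j)) \<le> cmod (G $$ (p,k)) * cmod (W $$ (p,j))"
        using pmax[of k] ap by (auto simp: D_def norm_mult S_def intro!: mult_left_mono)
    qed
    also have "\<dots> = (\<Sum>k<n. cmod (G $$ (p,k))) * cmod (W $$ (p,j))"
      by (rule sum_distrib_right[symmetric])
    also have "\<dots> \<le> B * cmod (W $$ (p,j))"
      unfolding B_def using pn
      by (intro mult_right_mono member_le_sum[of p _ "\<lambda>i. \<Sum>k<n. cmod (G $$ (i,k))"])
        (auto intro: sum_nonneg)
    finally show ?thesis using pos ap by simp
  qed
  \<comment> \<open>A column supported on two classes would have its eigenvalue within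
    \<open>B\<close> of two centres that are more than \<open>2 * B\<close> apart.\<close>
  have const: "a0 i = a0 k" if "i < n" "k < n" "j < n" "W $$ (i,j) \<noteq> 0" "W $$ (k,j) \<noteq> 0" for i j k
    using near[of i j] near[of k j] gap[of i k] gap[of k i] that
    by (cases "a0 i" "a0 k" rule: linorder_cases) (auto simp: right_diff_distrib abs_le_iff)
  have WW: "(\<Sum>k<n. cnj (W $$ (k,i)) * W $$ (k,j)) = (if i = j then 1 else 0)"
    if ij: "i < n" "j < n" for i j
  proof -
    have "(\<Sum>k<n. cnj (W $$ (k,i)) * W $$ (k,j)) = (\<Sum>k<n. adj W $$ (i,k) * W $$ (k,j))"
      using w(1) ij by (intro sum.cong refl) simp
    also have "\<dots> = 1\<^sub>m n $$ (i,j)"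
      unfolding index_mult_mat_sum[OF w(2,1) ij, symmetric] w(3) ..
    finally show ?thesis using ij by simp
  qed
  have "\<exists>s<n. W $$ (s,j) \<noteq> 0" if "j < n" for j
  proof (rule ccontr)
    assume "\<not> (\<exists>s<n. W $$ (s,j) \<noteq> 0)"
    then show False using WW[OF that that] by simp
  qed
  then obtain s where s: "\<And>j. j < n \<Longrightarrow> s j < n" "\<And>j. j < n \<Longrightarrow> W $$ (s j, j) \<noteq> 0" by metis
  \<comment> \<open>Column \<open>j\<close> of \<open>W\<close> lives on a single class, so any
    nonzero position \<open>s j\<close> reveals the eigenvalue of \<open>H\<close> that belongs to
    it. Removing the shift \<open>c * a j\<close> from \<open>m j\<close> leaves the eigenvalue
    \<open>d j\<close> of the compression of \<open>K\<close>.\<close>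
  define a where "a j = a0 (s j)" for j
  define d where "d j = m j - c * a j" for j
  have a: "a0 i = a j" if "i < n" "j < n" "W $$ (i,j) \<noteq> 0" for i j
    unfolding a_def using const[OF that(1) s(1) _ that(3) s(2)] that by simp
  define Q where "Q = Q1 * W"
  have Q: "is_unitary n Q" unfolding Q_def by (rule is_unitary_mult[OF Q1 W])
  have 1: "adj Q * H * Q = mat_diag n (\<lambda>i. complex_of_real (a i))"
  proof -
    have "mat_diag n (\<lambda>i. complex_of_real (a0 i)) * W = W * mat_diag n (\<lambda>i. complex_of_real (a i))"
      unfolding mat_diag_mult_left[OF w(1)] mat_diag_mult_right[OF w(1)]
      using a by (intro cong_mat refl) auto
    then have "adj W * (mat_diag n (\<lambda>i. complex_of_real (a0 i)) * W) =
        adj W * W * mat_diag n (\<lambda>i. complex_of_real (a i))"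
      using assoc_mult_mat[OF w(2,1) mat_diag_dim] by simp
    then show ?thesis
      unfolding Q_def unitary_similar_mult[OF q(1) w(1) H(1)] a0
        assoc_mult_mat[OF w(2) mat_diag_dim w(1)] w(3) left_mult_one_mat[OF mat_diag_dim] .
  qed
  have 2: "(adj Q * K * Q) $$ (i,j) = (if i = j then complex_of_real (d i) else 0)"
    if ij: "i < n" "j < n" and aij: "a i = a j" for i j
  proof -
    have "(adj Q * K * Q) $$ (i,j) = (adj W * (G * W)) $$ (i,j)"
      unfolding Q_def unitary_similar_mult[OF q(1) w(1) K(1)] G_def[symmetric]
        assoc_mult_mat[OF w(2) G w(1)] ..
    also have "\<dots> = (\<Sum>k<n. adj W $$ (i,k) * (G * W) $$ (k,j))"
      by (rule index_mult_mat_sum[OF w(2) mult_carrier_mat[OF G w(1)] ij])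
    also have "\<dots> = (\<Sum>k<n. complex_of_real (d j) * (cnj (W $$ (k,i)) * W $$ (k,j)))"
    proof (rule sum.cong[OF refl])
      fix k assume "k \<in> {..<n}"
      then have k: "k < n" by simp
      show "adj W $$ (i,k) * (G * W) $$ (k,j) = complex_of_real (d j) * (cnj (W $$ (k,i)) * W $$ (k,j))"
      proof (cases "W $$ (k,i) = 0")
        case False
        then have ak: "a0 k = a j" using a[OF k ij(1)] aij by simp
        have "(G * W) $$ (k,j) = (\<Sum>l<n. G $$ (k,l) * W $$ (l,j))"
          by (rule index_mult_mat_sum[OF G w(1) k ij(2)])
        \<comment> \<open>Entries of \<open>G\<close> that leave the class of \<open>k\<close> meet
          zeros of column \<open>j\<close>, because \<open>k\<close> is in the class that supports
          this column.\<close>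
        also have "\<dots> = (\<Sum>l<n. D k l * W $$ (l,j))"
          using a[OF _ ij(2)] ak by (intro sum.cong refl) (force simp: D_def)
        also have "\<dots> = complex_of_real (d j) * W $$ (k,j)"
          unfolding D[OF k ij(2)] d_def ak ..
        finally show ?thesis using w(1) k ij by simp
      qed (use w(1) k ij in simp)
    qed
    also have "\<dots> = (if i = j then complex_of_real (d i) else 0)"
      unfolding sum_distrib_left[symmetric] WW[OF ij] by simp
    finally show ?thesis .
  qed
  \<comment> \<open>If \<open>a i < a j\<close>, the gap exceeds both errors together and forces
    \<open>m i < m j\<close>, against the sorting of \<open>m\<close>. If \<open>a i = a j\<close>,
    the shifts agree and the order of \<open>d\<close> is that of \<open>m\<close>.\<close>
  have 3: "Dual (a j) (d j) \<le> Dual (a i) (d i)" if le: "i \<le> j" and j: "j < n" for i j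
  proof -
    have "\<bar>m i - c * a i\<bar> \<le> B" "\<bar>m j - c * a j\<bar> \<le> B"
      using near s le j by (simp_all add: a_def)
    moreover have "a i < a j \<Longrightarrow> 2 * B < c * a j - c * a i"
      using gap[of "s j" "s i"] s le j by (simp add: a_def right_diff_distrib)
    ultimately show ?thesis
      using m[OF le j] unfolding less_eq_dual_def d_def
      by (cases "a i" "a j" rule: linorder_cases) (auto simp: abs_le_iff)
  qed
  show ?thesis
    by (intro exI[of _ Q] exI[of _ a] exI[of _ d] conjI allI impI) (use Q 1 2 3 in auto)
qed

section \<open>Dual complex matrices\<close>

lemma std_mat_simps [simp]:
  "dim_row (std_mat A) = dim_row A" "dim_col (std_mat A) = dim_col A"
  "i < dim_row A \<Longrightarrow> j < dim_col A \<Longrightarrow> std_mat A $$ (i,j) = std_part (A $$ (i,j))"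
  by (simp_all add: std_mat_def)

lemma inf_mat_simps [simp]:
  "dim_row (inf_mat A) = dim_row A" "dim_col (inf_mat A) = dim_col A"
  "i < dim_row A \<Longrightarrow> j < dim_col A \<Longrightarrow> inf_mat A $$ (i,j) = inf_part (A $$ (i,j))"
  by (simp_all add: inf_mat_def)

lemma lift_mat_simps [simp]:
  "dim_row (lift_mat A) = dim_row A" "dim_col (lift_mat A) = dim_col A"
  "i < dim_row A \<Longrightarrow> j < dim_col A \<Longrightarrow> lift_mat A $$ (i,j) = dual_of_complex (A $$ (i,j))"
  by (simp_all add: lift_mat_def)

lemma dual_mat_dim [simp]:
  "dim_row (dual_mat A B) = dim_row B" "dim_col (dual_mat A B) = dim_col B"
  by (simp_all add: dual_mat_def)

lemma dual_mat_index [simp]: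
  "i < dim_row A \<Longrightarrow> i < dim_row B \<Longrightarrow> j < dim_col A \<Longrightarrow> j < dim_col B \<Longrightarrow>
    dual_mat A B $$ (i,j) = Dual (A $$ (i,j)) (B $$ (i,j))"
  by (simp add: dual_mat_def dual_eq_iff)

lemma parts_carrier [simp]:
  "A \<in> carrier_mat n m \<Longrightarrow> std_mat A \<in> carrier_mat n m"
  "A \<in> carrier_mat n m \<Longrightarrow> inf_mat A \<in> carrier_mat n m"
  "X \<in> carrier_mat n m \<Longrightarrow> lift_mat X \<in> carrier_mat n m"
  "Y \<in> carrier_mat n m \<Longrightarrow> dual_mat X Y \<in> carrier_mat n m"
  by (auto intro!: carrier_matI)

lemma dual_mat_eqI:
  assumes "A \<in> carrier_mat n m" "B \<in> carrier_mat n m" "std_mat A = std_mat B" "inf_mat A = inf_mat B"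
  shows "A = B"
proof (rule eq_matI)
  fix i j assume ij: "i < dim_row B" "j < dim_col B"
  then have "std_mat A $$ (i,j) = std_mat B $$ (i,j)" "inf_mat A $$ (i,j) = inf_mat B $$ (i,j)"
    using assms by simp_all
  then show "A $$ (i,j) = B $$ (i,j)" using assms(1,2) ij by (simp add: dual_eq_iff)
qed (use assms in auto)

lemma dual_mat_parts [simp]:
  assumes "X \<in> carrier_mat n m" "Y \<in> carrier_mat n m"
  shows "std_mat (dual_mat X Y) = X" "inf_mat (dual_mat X Y) = Y"
  using assms by (auto intro!: eq_matI)

lemma dual_mat_of_parts: "dual_mat (std_mat A) (inf_mat A) = A"
  by (rule eq_matI) (auto simp: dual_eq_iff)

lemma std_mat_mult:
  assumes A: "A \<in> carrier_mat n m" and B: "B \<in> carrier_mat m k"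
  shows "std_mat (A * B) = std_mat A * std_mat B"
proof (rule eq_matI)
  fix i j assume "i < dim_row (std_mat A * std_mat B)" "j < dim_col (std_mat A * std_mat B)"
  then have i: "i < n" and j: "j < k" using A B by auto
  have "(std_mat A * std_mat B) $$ (i,j) = (\<Sum>l<m. std_mat A $$ (i,l) * std_mat B $$ (l,j))"
    by (rule index_mult_mat_sum) (use A B i j in auto)
  then show "std_mat (A * B) $$ (i,j) = (std_mat A * std_mat B) $$ (i,j)"
    using A B i j index_mult_mat_sum[OF A B i j] by simp
qed (use A B in auto)

lemma inf_mat_mult:
  assumes A: "A \<in> carrier_mat n m" and B: "B \<in> carrier_mat m k"
  shows "inf_mat (A * B) = std_mat A * inf_mat B + inf_mat A * std_mat B"
proof (rule eq_matI)
  fix i j assume "i < dim_row (std_mat A * inf_mat B + inf_mat A * std_mat B)"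
    "j < dim_col (std_mat A * inf_mat B + inf_mat A * std_mat B)"
  then have i: "i < n" and j: "j < k" using A B by auto
  have "(std_mat A * inf_mat B) $$ (i,j) = (\<Sum>l<m. std_mat A $$ (i,l) * inf_mat B $$ (l,j))"
    "(inf_mat A * std_mat B) $$ (i,j) = (\<Sum>l<m. inf_mat A $$ (i,l) * std_mat B $$ (l,j))"
    by (rule index_mult_mat_sum; use A B i j in simp)+
  then show "inf_mat (A * B) $$ (i,j) = (std_mat A * inf_mat B + inf_mat A * std_mat B) $$ (i,j)"
    using A B i j index_mult_mat_sum[OF A B i j] by (simp add: sum.distrib)
qed (use A B in auto)

lemma parts_adj: "std_mat (adj A) = adj (std_mat A)" "inf_mat (adj A) = adj (inf_mat A)"
  for A :: "complex dual mat"
  by (auto intro!: eq_matI)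

lemma parts_one [simp]: "std_mat (1\<^sub>m n) = 1\<^sub>m n" "inf_mat (1\<^sub>m n) = 0\<^sub>m n n"
  by (auto intro!: eq_matI)

lemma dual_adjoint_eq_adj: "dual_adjoint A = adj A"
  unfolding dual_adjoint_def mat_adjoint_eq_adj parts_adj[symmetric] dual_mat_of_parts ..

lemma is_unitary_iff_dual_unitary: "U \<in> dual_unitary n \<longleftrightarrow> is_unitary n U"
proof
  assume U: "U \<in> dual_unitary n"
  then have c: "U \<in> carrier_mat n n" and inv: "invertible_mat U" and e: "mat_inv U = adj U"
    by (auto simp: dual_unitary_def dual_adjoint_eq_adj)
  from inv obtain V where V: "U * V = 1\<^sub>m n" "V * U = 1\<^sub>m (dim_row V)"
    using c by (auto simp: invertible_mat_def inverts_mat_def)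
  have "V \<in> carrier_mat n n"
    using arg_cong[OF V(1), of dim_col] arg_cong[OF V(2), of dim_col] c by auto
  with V c have "mat_inv U = V" by (intro mat_inv_eqI) auto
  then show "is_unitary n U" using e V \<open>V \<in> carrier_mat n n\<close> c by (auto simp: is_unitary_def)
next
  assume U: "is_unitary n U"
  note u = is_unitaryD[OF U]
  have "mat_inv U = adj U" by (rule mat_inv_eqI[OF u(1,2,4,3)])
  moreover have "invertible_mat U"
    unfolding invertible_mat_def inverts_mat_def using u by auto
  ultimately show "U \<in> dual_unitary n" using u by (auto simp: dual_unitary_def dual_adjoint_eq_adj)
qed

text \<open>The field case settles the standard part. Since \<open>B * A\<close> is idempotent with
  standard part 1, its infinitesimal part X satisfies X + X = X and is zero.\<close>

lemma dual_left_right_inverse: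
  fixes A B :: "complex dual mat"
  assumes A: "A \<in> carrier_mat n n" and B: "B \<in> carrier_mat n n" and AB: "A * B = 1\<^sub>m n"
  shows "B * A = 1\<^sub>m n"
proof -
  have BA: "B * A \<in> carrier_mat n n" by (rule mult_carrier_mat[OF B A])
  have "std_mat A * std_mat B = 1\<^sub>m n" unfolding std_mat_mult[OF A B, symmetric] AB by simp
  then have s: "std_mat (B * A) = 1\<^sub>m n"
    unfolding std_mat_mult[OF B A]
    by (rule mat_mult_left_right_inverse[OF parts_carrier(1)[OF A] parts_carrier(1)[OF B]])
  have "B * A * (B * A) = B * A"
    using mult_cancel_middle[OF B A B A AB] .
  then have "inf_mat (B * A) + inf_mat (B * A) = inf_mat (B * A)"
    using inf_mat_mult[OF BA BA]
    unfolding s left_mult_one_mat[OF parts_carrier(2)[OF BA]] right_mult_one_mat[OF parts_carrier(2)[OF BA]]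
    by simp
  then have i: "inf_mat (B * A) $$ (i,j) + inf_mat (B * A) $$ (i,j) = inf_mat (B * A) $$ (i,j)"
    if "i < n" "j < n" for i j
    using that A B index_add_mat(1)[of i "inf_mat (B * A)" j "inf_mat (B * A)"] by simp
  have "inf_mat (B * A) = 0\<^sub>m n n"
  proof (rule eq_matI)
    fix i j assume "i < dim_row (0\<^sub>m n n :: complex mat)" "j < dim_col (0\<^sub>m n n :: complex mat)"
    then have ij: "i < n" "j < n" by simp_all
    show "inf_mat (B * A) $$ (i,j) = 0\<^sub>m n n $$ (i,j)" using i[OF ij] ij by simp
  qed (use A B in simp_all)
  with s show ?thesis by (intro dual_mat_eqI[OF BA one_carrier_mat]) simp_all
qed

lemma is_unitaryI_dual:
  fixes U :: "complex dual mat"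
  assumes U: "U \<in> carrier_mat n n" and "adj U * U = 1\<^sub>m n"
  shows "is_unitary n U"
  unfolding is_unitary_def using assms dual_left_right_inverse[OF adj_carrier[OF U] U] by blast

lemma dual_diag_carrier [simp]: "dual_diag n \<mu> \<in> carrier_mat n n"
  by (simp add: dual_diag_def)

lemma dual_diag_dim [simp]: "dim_row (dual_diag n \<mu>) = n" "dim_col (dual_diag n \<mu>) = n"
  by (simp_all add: dual_diag_def mat_diag_def)

lemma dual_diag_index:
  "i < n \<Longrightarrow> j < n \<Longrightarrow>
    dual_diag n \<mu> $$ (i,j) = (if i = j then dual_complex_of_dual (\<mu> i) else 0)"
  by (simp add: dual_diag_def mat_diag_def)

section \<open>The spectral theorem for dual Hermitian matrices\<close>

text \<open>
  In an eigenbasis of the standard part, the infinitesimal part acts by the commutator with the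
  generator \<open>Z\<close>; this removes exactly the entries between distinct eigenvalues.
  For equal eigenvalues, division by zero makes the entry of \<open>Z\<close> vanish, as it should.
\<close>

theorem dual_hermitian_spectral:
  fixes H :: "complex dual mat"
  assumes H: "H \<in> carrier_mat n n" and herm: "adj H = H"
  shows "\<exists>U lam. is_unitary n U \<and> adj U * H * U = dual_diag n lam \<and>
    (\<forall>i j. i \<le> j \<and> j < n \<longrightarrow> lam j \<le> lam i)"
proof -
  note Hs = parts_carrier(1)[OF H] and Hd = parts_carrier(2)[OF H]
  have hs: "adj (std_mat H) = std_mat H" and hd: "adj (inf_mat H) = inf_mat H"
    unfolding parts_adj[symmetric] herm by simp_all
  obtain Q and a d :: "nat \<Rightarrow> real" where Q: "is_unitary n Q"
    and a: "adj Q * std_mat H * Q = mat_diag n (\<lambda>i. complex_of_real (a i))"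
    and d: "\<forall>i<n. \<forall>j<n. a i = a j \<longrightarrow>
      (adj Q * inf_mat H * Q) $$ (i,j) = (if i = j then complex_of_real (d i) else 0)"
    and sorted: "\<forall>i j. i \<le> j \<and> j < n \<longrightarrow> Dual (a j) (d j) \<le> Dual (a i) (d i)"
    using hermitian_pair_spectral[OF Hs hs Hd hd] by (elim exE conjE) (rule that)
  note q = is_unitaryD[OF Q]
  define F where "F = adj Q * inf_mat H * Q"
  have F: "F \<in> carrier_mat n n"
    unfolding F_def by (rule mult_carrier_mat[OF mult_carrier_mat[OF q(2) Hd] q(1)])
  have hF: "adj F = F" unfolding F_def by (rule hermitian_unitary_similar[OF Q Hd hd])
  define Z where "Z = mat n n (\<lambda>(i,j). - F $$ (i,j) / complex_of_real (a i - a j))"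
  have Z: "Z \<in> carrier_mat n n" unfolding Z_def by simp
  have aZ: "adj Z = - Z"
  proof (rule eq_matI)
    fix i j assume "i < dim_row (- Z)" "j < dim_col (- Z)"
    then have ij: "i < n" "j < n" using Z by auto
    have "cnj (F $$ (j,i)) = adj F $$ (i,j)" using F ij by simp
    then have cF: "cnj (F $$ (j,i)) = F $$ (i,j)" unfolding hF .
    have e: "complex_of_real (a j - a i) = - complex_of_real (a i - a j)" by simp
    have Zij: "Z $$ (i,j) = - F $$ (i,j) / complex_of_real (a i - a j)"
      unfolding Z_def using ij by simp
    have "adj Z $$ (i,j) = cnj (Z $$ (j,i))" using ij Z by simp
    also have "Z $$ (j,i) = - F $$ (j,i) / complex_of_real (a j - a i)"
      unfolding Z_def using ij by simp
    also have "cnj \<dots> = - cnj (F $$ (j,i)) / complex_of_real (a j - a i)" by simp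
    also have "\<dots> = - F $$ (i,j) / - complex_of_real (a i - a j)"
      unfolding cF e ..
    also have "\<dots> = - (Z $$ (i,j))"
      unfolding Zij by (simp only: minus_divide_divide minus_divide_left minus_minus)
    also have "\<dots> = (- Z) $$ (i,j)" using ij Z by simp
    finally show "adj Z $$ (i,j) = (- Z) $$ (i,j)" .
  qed (use Z in auto)
  note QZ = mult_carrier_mat[OF q(1) Z]
  \<comment> \<open>This is \<open>Q\<close> times 1 + eps \<open>Z\<close>; to first order it is
    unitary because \<open>Z\<close> is skew-Hermitian.\<close>
  define U where "U = dual_mat Q (Q * Z)"
  have U: "U \<in> carrier_mat n n" unfolding U_def by (rule parts_carrier(4)[OF QZ])
  note aU = adj_carrier[OF U]
  have Us: "std_mat U = Q" and Ud: "inf_mat U = Q * Z"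
    unfolding U_def by (rule dual_mat_parts[OF q(1) QZ])+
  have aQZ: "adj (Q * Z) = - Z * adj Q" unfolding adj_mult[OF q(1) Z] aZ ..
  have mZ: "- Z \<in> carrier_mat n n" using Z by simp
  have QQZ: "adj Q * (Q * Z) = Z"
    unfolding assoc_mult_mat[OF q(2,1) Z, symmetric] q(3) by (rule left_mult_one_mat[OF Z])
  have "adj U * U = 1\<^sub>m n"
  proof (rule dual_mat_eqI[OF mult_carrier_mat[OF aU U] one_carrier_mat])
    show "std_mat (adj U * U) = std_mat (1\<^sub>m n)"
      unfolding std_mat_mult[OF aU U] parts_adj Us q(3) by simp
    have "inf_mat (adj U * U) = Z + - Z * adj Q * Q"
      unfolding inf_mat_mult[OF aU U] parts_adj Us Ud QQZ aQZ ..
    also have "- Z * adj Q * Q = - Z"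
      unfolding assoc_mult_mat[OF mZ q(2,1)] q(3) by (rule right_mult_one_mat[OF mZ])
    finally show "inf_mat (adj U * U) = inf_mat (1\<^sub>m n)"
      using Z by (auto intro!: eq_matI)
  qed
  then have UU: "is_unitary n U" by (rule is_unitaryI_dual[OF U])
  note aUH = mult_carrier_mat[OF aU H]
  have "adj U * H * U = dual_diag n (\<lambda>i. Dual (a i) (d i))"
  proof (rule dual_mat_eqI[OF mult_carrier_mat[OF aUH U] dual_diag_carrier])
    have "std_mat (adj U * H * U) = mat_diag n (\<lambda>i. complex_of_real (a i))"
      unfolding std_mat_mult[OF aUH U] std_mat_mult[OF aU H] parts_adj Us a ..
    then show "std_mat (adj U * H * U) = std_mat (dual_diag n (\<lambda>i. Dual (a i) (d i)))"
      by (auto intro!: eq_matI simp: dual_diag_index mat_diag_def)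
    have "inf_mat (adj U * H * U) = adj Q * std_mat H * (Q * Z) +
        (adj Q * inf_mat H + - Z * adj Q * std_mat H) * Q"
      unfolding inf_mat_mult[OF aUH U] std_mat_mult[OF aU H] inf_mat_mult[OF aU H] parts_adj Us Ud
        aQZ ..
    also have "adj Q * std_mat H * (Q * Z) = mat_diag n (\<lambda>i. complex_of_real (a i)) * Z"
      unfolding a[symmetric] assoc_mult_mat[OF mult_carrier_mat[OF q(2) Hs] q(1) Z] ..
    also have "(adj Q * inf_mat H + - Z * adj Q * std_mat H) * Q = F + - Z * adj Q * std_mat H * Q"
      unfolding F_def
      by (rule add_mult_distrib_mat[OF mult_carrier_mat[OF q(2) Hd]
          mult_carrier_mat[OF mult_carrier_mat[OF mZ q(2)] Hs] q(1)])
    also have "- Z * adj Q * std_mat H * Q = - Z * mat_diag n (\<lambda>i. complex_of_real (a i))"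
      unfolding a[symmetric] assoc_mult_mat[OF mZ q(2) Hs]
        assoc_mult_mat[OF mZ mult_carrier_mat[OF q(2) Hs] q(1)] ..
    finally have e: "inf_mat (adj U * H * U) = mat_diag n (\<lambda>i. complex_of_real (a i)) * Z +
      (F + - Z * mat_diag n (\<lambda>i. complex_of_real (a i)))" .
    show "inf_mat (adj U * H * U) = inf_mat (dual_diag n (\<lambda>i. Dual (a i) (d i)))"
      unfolding e mat_diag_mult_left[OF Z] mat_diag_mult_right[OF mZ]
    proof (rule eq_matI)
      fix i j assume "i < dim_row (inf_mat (dual_diag n (\<lambda>i. Dual (a i) (d i))))"
        "j < dim_col (inf_mat (dual_diag n (\<lambda>i. Dual (a i) (d i))))"
      then have ij: "i < n" "j < n" by auto
      have "complex_of_real (a i) * Z $$ (i,j) + (F $$ (i,j) + (- Z) $$ (i,j) * complex_of_real (a j))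
          = F $$ (i,j) + complex_of_real (a i - a j) * Z $$ (i,j)"
        using ij Z by (simp add: algebra_simps)
      also have "\<dots> = (if i = j then complex_of_real (d i) else 0)"
      proof (cases "a i = a j")
        case True
        then show ?thesis using d ij by (simp add: F_def)
      next
        case False
        then have "complex_of_real (a i - a j) * Z $$ (i,j) = - F $$ (i,j)"
          using ij unfolding Z_def by simp
        with False show ?thesis by auto
      qed
      finally show "(mat n n (\<lambda>(i, j). complex_of_real (a i) * Z $$ (i, j)) +
          (F + mat n n (\<lambda>(i, j). (- Z) $$ (i, j) * complex_of_real (a j)))) $$ (i, j) =
          inf_mat (dual_diag n (\<lambda>i. Dual (a i) (d i))) $$ (i, j)"
        using ij F by (simp add: dual_diag_index)
    qed (use F in simp_all)
  qed
  with UU sorted show ?thesis by blast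
qed

section \<open>Rank and inner inverses\<close>

definition tr :: "'a::comm_monoid_add mat \<Rightarrow> 'a" where
  "tr A = (\<Sum>i<dim_row A. A $$ (i,i))"

lemma tr_mult_comm:
  fixes A B :: "'a::comm_semiring_0 mat"
  assumes A: "A \<in> carrier_mat n m" and B: "B \<in> carrier_mat m n"
  shows "tr (A * B) = tr (B * A)"
proof -
  have "tr (A * B) = (\<Sum>i<n. \<Sum>l<m. A $$ (i,l) * B $$ (l,i))"
    unfolding tr_def using A by (auto intro!: sum.cong index_mult_mat_sum[OF A B])
  also have "\<dots> = (\<Sum>l<m. \<Sum>i<n. B $$ (l,i) * A $$ (i,l))"
    by (subst sum.swap) (simp add: mult.commute)
  also have "\<dots> = tr (B * A)"
    unfolding tr_def using B by (auto intro!: sum.cong index_mult_mat_sum[OF B A, symmetric])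
  finally show ?thesis .
qed

text \<open>Dual numbers form a local ring, which has only the trivial idempotents. So the spectrum
  of a Gram projection carries no infinitesimal parts.\<close>

lemma real_dual_idempotent:
  fixes x :: "real dual"
  assumes "x * x = x"
  shows "x = 0 \<or> x = 1"
  using assms by (auto simp: dual_eq_iff algebra_simps)

lemma dual_complex_of_dual_simps:
  "dual_complex_of_dual (x * y) = dual_complex_of_dual x * dual_complex_of_dual y"
  "dual_complex_of_dual 0 = 0" "dual_complex_of_dual 1 = 1"
  "dual_complex_of_dual x = dual_complex_of_dual y \<longleftrightarrow> x = y"
  by (auto simp: dual_eq_iff)

text \<open>
  The Gram matrix of the rows is an idempotent of trace \<open>r\<close>, so the spectral theorem turns the
  rows into the first \<open>r\<close> coordinates.
\<close>

lemma orthonormal_rows_completion: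
  fixes N :: "complex dual mat"
  assumes N: "N \<in> carrier_mat r n" and NN: "N * adj N = 1\<^sub>m r" and rn: "r \<le> n"
  shows "\<exists>V. is_unitary n V \<and> (\<forall>i<r. \<forall>j<n. (N * V) $$ (i,j) = (if i = j then 1 else 0))"
proof -
  note aN = adj_carrier[OF N]
  have E: "adj N * N \<in> carrier_mat n n" by (rule mult_carrier_mat[OF aN N])
  have "adj (adj N * N) = adj N * N" unfolding adj_mult[OF aN N] by simp
  from dual_hermitian_spectral[OF E this] obtain V lam where V: "is_unitary n V"
    and lam: "adj V * (adj N * N) * V = dual_diag n lam"
    and sorted: "\<forall>i j. i \<le> j \<and> j < n \<longrightarrow> lam j \<le> lam i" by blast
  note v = is_unitaryD[OF V]
  define M where "M = N * V"
  have M: "M \<in> carrier_mat r n" unfolding M_def by (rule mult_carrier_mat[OF N v(1)])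
  note aM = adj_carrier[OF M]
  have MaM: "M * adj M = 1\<^sub>m r"
    unfolding M_def adj_mult[OF N v(1)] mult_cancel_middle[OF N v(1,2) aN v(4)] by (rule NN)
  have aMM: "adj M * M = dual_diag n lam"
    unfolding M_def adj_mult[OF N v(1)] lam[symmetric]
      assoc_mult_mat[OF v(2) aN mult_carrier_mat[OF N v(1)]]
      assoc_mult_mat[OF v(2) E v(1)] assoc_mult_mat[OF aN N v(1)] ..
  have Ml: "M * dual_diag n lam = M"
    unfolding aMM[symmetric] assoc_mult_mat[OF M aM M, symmetric] MaM by (rule left_mult_one_mat[OF M])
  have "dual_diag n lam * dual_diag n lam = dual_diag n lam"
    unfolding aMM[symmetric] assoc_mult_mat[OF aM M mult_carrier_mat[OF aM M]]
      assoc_mult_mat[OF M aM M, symmetric] MaM left_mult_one_mat[OF M] ..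
  then have "dual_diag n (\<lambda>i. lam i * lam i) = dual_diag n lam"
    by (simp add: dual_diag_def dual_complex_of_dual_simps(1))
  then have ii: "dual_diag n (\<lambda>i. lam i * lam i) $$ (i,i) = dual_diag n lam $$ (i,i)" for i by simp
  have "lam i * lam i = lam i" if "i < n" for i
    using ii[of i] that by (simp add: dual_diag_index dual_complex_of_dual_simps(4))
  then have idem: "lam i = 0 \<or> lam i = 1" if "i < n" for i
    using real_dual_idempotent that by blast
  \<comment> \<open>The length of the initial run of ones; by the sorting only zeros follow it. The
    alternative \<open>n \<le> i\<close> makes the minimum exist and bounds it by
    \<open>n\<close>.\<close>
  define t where "t = (LEAST i. n \<le> i \<or> lam i \<noteq> 1)"
  have tn: "t \<le> n" unfolding t_def by (rule Least_le) simp
  have t1: "lam i = 1" if "i < t" for i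
    using not_less_Least[OF that[unfolded t_def]] by simp
  have t0: "lam i = 0" if "t \<le> i" "i < n" for i
  proof -
    have "n \<le> t \<or> lam t \<noteq> 1" unfolding t_def by (rule LeastI[of _ n]) simp
    then have "lam t = 0" using that idem[of t] by auto
    moreover have "lam i \<le> lam t" using sorted that by blast
    ultimately have "lam i \<noteq> 1" by (auto simp: less_eq_dual_def)
    then show ?thesis using idem that by blast
  qed
  \<comment> \<open>The trace of the Gram projection counts its ones, while cyclicity turns it into
    the trace of the identity of size \<open>r\<close>.\<close>
  have "(of_nat t :: complex dual) = (\<Sum>i<n. if i < t then 1 else 0)"
    using tn by (simp add: sum.If_cases Int_absorb1 lessThan_def[symmetric] subset_eq)
  also have "\<dots> = tr (adj M * M)"
    unfolding aMM tr_def using t1 t0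
    by (auto intro!: sum.cong simp: dual_diag_index dual_complex_of_dual_simps)
  also have "\<dots> = of_nat r" unfolding tr_mult_comm[OF aM M] MaM by (simp add: tr_def)
  finally have "std_part (of_nat t :: complex dual) = std_part (of_nat r)" by simp
  then have tr: "t = r" by simp
  have M0: "M $$ (i,j) = 0" if "i < r" "r \<le> j" "j < n" for i j
  proof -
    have "M $$ (i,j) = (M * dual_diag n lam) $$ (i,j)" unfolding Ml ..
    also have "\<dots> = M $$ (i,j) * dual_complex_of_dual (lam j)"
      unfolding dual_diag_def mat_diag_mult_right[OF M] using that by simp
    finally show ?thesis using t0[of j] that tr by (simp add: dual_complex_of_dual_simps)
  qed
  \<comment> \<open>The columns of \<open>M\<close> from \<open>r\<close> on vanish, so
    \<open>M\<close> is \<open>M1\<close> followed by zeros and \<open>M1\<close> is unitary. A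
    further factor \<open>adj M1\<close> on the first \<open>r\<close> coordinates turns this block
    into the identity.\<close>
  define M1 where "M1 = mat r r (\<lambda>(i,j). M $$ (i,j))"
  have M1: "M1 \<in> carrier_mat r r" unfolding M1_def by simp
  have M1sum: "(\<Sum>l<n. M $$ (i,l) * f l) = (\<Sum>l<r. M1 $$ (i,l) * f l)" if "i < r" for i f
  proof -
    have "(\<Sum>l<n. M $$ (i,l) * f l) = (\<Sum>l<r. M $$ (i,l) * f l)"
      using rn M0[OF that] by (intro sum.mono_neutral_right) auto
    then show ?thesis using that by (simp add: M1_def)
  qed
  have M1M1: "M1 * adj M1 = 1\<^sub>m r"
  proof (rule eq_matI)
    fix i j assume "i < dim_row (1\<^sub>m r :: complex dual mat)" "j < dim_col (1\<^sub>m r :: complex dual mat)"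
    then have ij: "i < r" "j < r" by auto
    have "(M1 * adj M1) $$ (i,j) = (\<Sum>l<r. M1 $$ (i,l) * adj M1 $$ (l,j))"
      by (rule index_mult_mat_sum[OF M1 adj_carrier[OF M1] ij])
    also have "\<dots> = (\<Sum>l<r. M1 $$ (i,l) * adj M $$ (l,j))"
      using ij rn M by (intro sum.cong refl) (simp add: M1_def)
    also have "\<dots> = (M * adj M) $$ (i,j)"
      unfolding M1sum[OF ij(1), symmetric] by (rule index_mult_mat_sum[OF M aM ij, symmetric])
    finally show "(M1 * adj M1) $$ (i,j) = 1\<^sub>m r $$ (i,j)" unfolding MaM .
  qed (use M1 in auto)
  have "is_unitary r M1"
    unfolding is_unitary_def using M1 M1M1 dual_left_right_inverse[OF M1 adj_carrier[OF M1]] by blast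
  moreover have "is_unitary (n - r) (1\<^sub>m (n - r) :: complex dual mat)" by (simp add: is_unitary_def)
  ultimately have W: "is_unitary n
      (four_block_mat (adj M1) (0\<^sub>m r (n - r)) (0\<^sub>m (n - r) r) (1\<^sub>m (n - r)))" (is "is_unitary n ?W")
    using is_unitary_block[of r "adj M1" "n - r"] is_unitary_adj rn by fastforce
  note w = is_unitaryD[OF W]
  have "(N * (V * ?W)) $$ (i,j) = (if i = j then 1 else 0)" if ij: "i < r" "j < n" for i j
  proof -
    have "(N * (V * ?W)) $$ (i,j) = (M * ?W) $$ (i,j)"
      unfolding M_def assoc_mult_mat[OF N v(1) w(1)] ..
    also have "\<dots> = (\<Sum>l<r. M1 $$ (i,l) * ?W $$ (l,j))"
      unfolding M1sum[OF ij(1), symmetric] by (rule index_mult_mat_sum[OF M w(1) ij])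
    also have "\<dots> = (\<Sum>l<r. if j < r then M1 $$ (i,l) * adj M1 $$ (l,j) else 0)"
      using ij M1 by (intro sum.cong refl) (auto simp: adj_dim)
    also have "\<dots> = (if j < r then (M1 * adj M1) $$ (i,j) else 0)"
      using index_mult_mat_sum[OF M1 adj_carrier[OF M1] ij(1)] by simp
    finally show ?thesis using ij unfolding M1M1 by simp
  qed
  with is_unitary_mult[OF V W] show ?thesis by blast
qed

section \<open>Singular values in the presence of an inner inverse\<close>

lemma top_blocks_carrier:
  assumes "X \<in> carrier_mat r r" "Y \<in> carrier_mat r (n - r)" "r \<le> n"
  shows "top_blocks n X Y \<in> carrier_mat n n"
  unfolding top_blocks_def using assms by (auto intro!: carrier_matI)

lemma top_blocks_index:
  assumes "X \<in> carrier_mat r r" "Y \<in> carrier_mat r (n - r)" "i < n" "j < n" "r \<le> n"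
  shows "top_blocks n X Y $$ (i,j) =
    (if i < r then if j < r then X $$ (i,j) else Y $$ (i, j - r) else 0)"
  unfolding top_blocks_def using assms by auto

text \<open>An infinitesimal \<open>\<mu>\<close> would make the left side of the second hypothesis
  a multiple of \<open>eps * eps\<close>, hence zero, although \<open>\<mu>\<close> is positive. So
  \<open>\<mu>\<close> is appreciable, that is, a unit, and may be cancelled.\<close>

lemma positive_dual_regular:
  fixes \<mu> :: "real dual" and y :: "complex dual"
  assumes "0 < \<mu>" and "dual_complex_of_dual \<mu> * y * dual_complex_of_dual \<mu> = dual_complex_of_dual \<mu>"
  shows "dual_complex_of_dual \<mu> * y = 1"
proof -
  obtain a b where \<mu>: "\<mu> = Dual a b" by (cases \<mu>)
  obtain c d where y: "y = Dual c d" by (cases y)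
  have a: "complex_of_real a * c * complex_of_real a = complex_of_real a"
    and b: "complex_of_real a * c * complex_of_real b +
      (complex_of_real a * d + complex_of_real b * c) * complex_of_real a = complex_of_real b"
    using assms(2) by (simp_all add: \<mu> y dual_eq_iff)
  have "a \<noteq> 0" using b assms(1) by (auto simp: \<mu> less_dual_def less_eq_dual_def)
  with a have ac: "complex_of_real a * c = 1" by simp
  with b have "(complex_of_real a * d + complex_of_real b * c) * complex_of_real a = 0" by simp
  with \<open>a \<noteq> 0\<close> ac show ?thesis by (simp add: \<mu> y dual_eq_iff)
qed

text \<open>Moving the unitary factors to \<open>X\<close> yields an inner inverse \<open>Y\<close>
  of the diagonal factor. On the diagonal of their product each singular value then contributes 1
  and every other row 0, and the trace is invariant under conjugation by \<open>P\<close>.\<close>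

lemma dual_svd_trace:
  assumes A: "A \<in> carrier_mat n n" and X: "X \<in> carrier_mat n n" and AXA: "A * X * A = A"
    and svd: "is_dual_svd A P t \<mu> V"
  shows "tr (A * X) = of_nat t"
proof -
  have P: "is_unitary n P" and V: "is_unitary n V" and tn: "t \<le> n"
    and pos: "\<And>i. i < t \<Longrightarrow> 0 < \<mu> i"
    and Ae: "A = P * top_blocks n (dual_diag t \<mu>) (0\<^sub>m t (n - t)) * adj V" (is "A = P * ?D * _")
    using svd A by (auto simp: is_dual_svd_def is_unitary_iff_dual_unitary dual_adjoint_eq_adj)
  note p = is_unitaryD[OF P] and v = is_unitaryD[OF V]
  have D: "?D \<in> carrier_mat n n" by (rule top_blocks_carrier) (use tn in auto)
  note PD = mult_carrier_mat[OF p(1) D] and VX = mult_carrier_mat[OF v(2) X]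
  define Y where "Y = adj V * X * P"
  have Y: "Y \<in> carrier_mat n n" unfolding Y_def by (rule mult_carrier_mat[OF VX p(1)])
  have PA: "adj P * A = ?D * adj V"
    unfolding Ae assoc_mult_mat[OF p(1) D v(2)]
      assoc_mult_mat[OF p(2,1) mult_carrier_mat[OF D v(2)], symmetric] p(3)
    by (rule left_mult_one_mat[OF mult_carrier_mat[OF D v(2)]])
  have AV: "A * V = P * ?D"
    unfolding Ae assoc_mult_mat[OF PD v(2,1)] v(3) by (rule right_mult_one_mat[OF PD])
  have PAV: "adj P * A * V = ?D"
    unfolding PA assoc_mult_mat[OF D v(2,1)] v(3) by (rule right_mult_one_mat[OF D])
  have DY: "?D * Y = adj P * (A * X) * P"
    unfolding Y_def assoc_mult_mat[OF D VX p(1), symmetric] assoc_mult_mat[OF D v(2) X, symmetric]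
      PA[symmetric] assoc_mult_mat[OF p(2) A X] ..
  have AX: "A * X \<in> carrier_mat n n" by (rule mult_carrier_mat[OF A X])
  have "?D * Y * ?D = adj P * (A * X) * (P * ?D)"
    unfolding DY by (rule assoc_mult_mat[OF mult_carrier_mat[OF p(2) AX] p(1) D])
  also have "\<dots> = adj P * (A * X * A) * V"
    unfolding AV[symmetric] assoc_mult_mat[OF mult_carrier_mat[OF p(2) AX] A v(1), symmetric]
      assoc_mult_mat[OF p(2) AX A] ..
  finally have DYD: "?D * Y * ?D = ?D" unfolding AXA PAV .
  have Di: "?D $$ (i,j) = (if i = j \<and> i < t then dual_complex_of_dual (\<mu> i) else 0)"
    if "i < n" "j < n" for i j
    by (subst top_blocks_index[of _ t]) (use that tn in \<open>auto simp: dual_diag_index\<close>)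
  have DYi: "(?D * Y) $$ (i,j) = (if i < t then dual_complex_of_dual (\<mu> i) * Y $$ (i,j) else 0)"
    if "i < n" "j < n" for i j
    unfolding index_mult_mat_sum[OF D Y that]
    using that by (subst sum.remove[of _ i]) (auto simp: Di intro!: sum.neutral)
  have "dual_complex_of_dual (\<mu> i) * Y $$ (i,i) = 1" if i: "i < t" for i
  proof -
    from i tn have ii: "i < n" by simp
    have "dual_complex_of_dual (\<mu> i) = (?D * Y * ?D) $$ (i,i)" unfolding DYD using Di[OF ii ii] i by simp
    also have "\<dots> = (?D * Y) $$ (i,i) * dual_complex_of_dual (\<mu> i)"
      unfolding index_mult_mat_sum[OF mult_carrier_mat[OF D Y] D ii ii]
      using ii i by (subst sum.remove[of _ i]) (auto simp: Di intro!: sum.neutral)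
    also have "(?D * Y) $$ (i,i) = dual_complex_of_dual (\<mu> i) * Y $$ (i,i)"
      using DYi[OF ii ii] i by simp
    finally show ?thesis by (intro positive_dual_regular pos[OF i]) simp
  qed
  then have "tr (?D * Y) = (\<Sum>i<n. if i < t then 1 else 0)"
    unfolding tr_def using D by (auto intro!: sum.cong simp: DYi)
  also have "\<dots> = of_nat t"
    using tn by (simp add: sum.If_cases Int_absorb1 lessThan_def[symmetric] subset_eq)
  also have "tr (?D * Y) = tr (A * X)"
    unfolding DY assoc_mult_mat[OF p(2) AX p(1)] tr_mult_comm[OF p(2) mult_carrier_mat[OF AX p(1)]]
      assoc_mult_mat[OF AX p(1,2)] p(4) right_mult_one_mat[OF AX] ..
  finally show ?thesis .
qed

text \<open>Two decompositions yield the same trace of \<open>A * X\<close>, which supplies the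
  uniqueness demanded by \<open>THE\<close>.\<close>

lemma dual_rank_eqI:
  assumes "A \<in> carrier_mat n n" "X \<in> carrier_mat n n" "A * X * A = A" "is_dual_svd A P r \<mu> V"
  shows "dual_rank A = r"
  unfolding dual_rank_def
proof (rule the_equality)
  fix t assume "\<exists>P \<mu> V. is_dual_svd A P t \<mu> V"
  then have "(of_nat t :: complex dual) = of_nat r"
    using dual_svd_trace[OF assms(1-3)] assms(4) by metis
  then have "std_part (of_nat t :: complex dual) = std_part (of_nat r)" by simp
  then show "t = r" by simp
qed (use assms(4) in blast)

section \<open>Core matrices\<close>

text \<open>The range condition in the form of a factorization: column \<open>j\<close> of
  \<open>W\<close> is a preimage of column \<open>j\<close> of \<open>A\<close> under
  \<open>A * A\<close>.\<close>

lemma dual_CM_factor: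
  assumes "A \<in> dual_CM n"
  shows "A \<in> carrier_mat n n" "\<exists>W\<in>carrier_mat n n. A = A * A * W"
proof -
  show A: "A \<in> carrier_mat n n" using assms by (simp add: dual_CM_def)
  have AA: "A * A \<in> carrier_mat n n" by (rule mult_carrier_mat[OF A A])
  have r: "dual_range (A * A) = dual_range A" using assms by (simp add: dual_CM_def)
  have "\<exists>x. x \<in> carrier_vec n \<and> col A j = (A * A) *\<^sub>v x" if "j < n" for j
  proof -
    have "col A j = A *\<^sub>v unit_vec n j" using A that by (intro eq_vecI) auto
    then have "col A j \<in> dual_range A" using A unfolding dual_range_def by auto
    then have "col A j \<in> dual_range (A * A)" unfolding r .
    then show ?thesis using A unfolding dual_range_def by auto
  qed
  then obtain x where x: "\<And>j. j < n \<Longrightarrow> x j \<in> carrier_vec n"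
    "\<And>j. j < n \<Longrightarrow> col A j = (A * A) *\<^sub>v x j" by metis
  define W where "W = mat n n (\<lambda>(i,j). x j $ i)"
  have W: "W \<in> carrier_mat n n" unfolding W_def by simp
  have "A = A * A * W"
  proof (rule eq_matI)
    fix i j assume "i < dim_row (A * A * W)" "j < dim_col (A * A * W)"
    then have ij: "i < n" "j < n" using A W by auto
    have "col W j = x j" using x(1)[OF ij(2)] ij unfolding W_def by (intro eq_vecI) auto
    then have "(A * A * W) $$ (i,j) = row (A * A) i \<bullet> x j"
      using index_mult_mat(1)[of i "A * A" j W] carrier_matD[OF AA] carrier_matD[OF W] ij by simp
    also have "\<dots> = ((A * A) *\<^sub>v x j) $ i"
      using index_mult_mat_vec[of i "A * A" "x j"] carrier_matD[OF AA] ij by simp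
    also have "\<dots> = col A j $ i" unfolding x(2)[OF ij(2)] ..
    finally show "A $$ (i,j) = (A * A * W) $$ (i,j)" using A ij by simp
  qed (use A W in auto)
  with W show "\<exists>W\<in>carrier_mat n n. A = A * A * W" by blast
qed

lemma unitary_conj_mult:
  fixes A B :: "'a::{comm_ring_1,conjugatable_ring} mat"
  assumes U: "is_unitary n U" and A: "A \<in> carrier_mat n n" and B: "B \<in> carrier_mat n n"
  shows "(U * A * adj U) * (U * B * adj U) = U * (A * B) * adj U"
proof -
  note u = is_unitaryD[OF U]
  have "(U * A * adj U) * (U * B * adj U) = U * A * adj U * (U * (B * adj U))"
    unfolding assoc_mult_mat[OF u(1) B u(2)] ..
  also have "\<dots> = U * A * (B * adj U)"
    by (rule mult_cancel_middle[OF mult_carrier_mat[OF u(1) A] u(2,1) mult_carrier_mat[OF B u(2)] u(3)])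
  also have "\<dots> = U * (A * B) * adj U"
    unfolding assoc_mult_mat[OF mult_carrier_mat[OF u(1) A] B u(2), symmetric]
      assoc_mult_mat[OF u(1) A B] ..
  finally show ?thesis .
qed

text \<open>\<open>N\<close> is the block row of K and L before it is cut in two, and
  \<open>J\<close> witnesses that the standard part of K is invertible. The unitary matrix comes
  from the spectral theorem for \<open>A * adj A\<close>; \<open>B * Y = B\<close> supplies the
  rest.\<close>

lemma dual_CM_unitary_rows:
  assumes CM: "A \<in> dual_CM n"
  shows "\<exists>U r \<mu> N J. r \<le> n \<and> is_unitary n U \<and> N \<in> carrier_mat r n \<and> N * adj N = 1\<^sub>m r \<and>
    (\<forall>i<r. 0 < \<mu> i \<and> appreciable (\<mu> i)) \<and> (\<forall>i j. i \<le> j \<and> j < r \<longrightarrow> \<mu> j \<le> \<mu> i) \<and>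
    J \<in> carrier_mat r r \<and> mat r r (\<lambda>(i,j). std_part (N $$ (i,j))) * J = 1\<^sub>m r \<and>
    (\<forall>i<n. \<forall>j<n. (adj U * A * U) $$ (i,j) =
      (if i < r then dual_complex_of_dual (\<mu> i) * N $$ (i,j) else 0))"
proof -
  note A = dual_CM_factor(1)[OF CM]
  obtain W where W: "W \<in> carrier_mat n n" and AW: "A = A * A * W"
    using dual_CM_factor(2)[OF CM] by blast
  note aA = adj_carrier[OF A]
  have H: "A * adj A \<in> carrier_mat n n" by (rule mult_carrier_mat[OF A aA])
  have "adj (A * adj A) = A * adj A" unfolding adj_mult[OF A aA] by simp
  from dual_hermitian_spectral[OF H this] obtain U lam where U: "is_unitary n U"
    and lam: "adj U * (A * adj A) * U = dual_diag n lam"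
    and sorted: "\<forall>i j. i \<le> j \<and> j < n \<longrightarrow> lam j \<le> lam i" by (elim exE conjE) (rule that)
  note u = is_unitaryD[OF U]
  note U' = is_unitary_adj[OF U]
  define B where "B = adj U * A * U"
  have B: "B \<in> carrier_mat n n"
    unfolding B_def by (rule mult_carrier_mat[OF mult_carrier_mat[OF u(2) A] u(1)])
  note aB = adj_carrier[OF B]
  have aBe: "adj B = adj U * adj A * U"
    unfolding B_def adj_mult[OF mult_carrier_mat[OF u(2) A] u(1)] adj_mult[OF u(2) A]
      assoc_mult_mat[OF u(2) aA u(1)] by simp
  have BB: "B * adj B = dual_diag n lam"
    unfolding aBe unfolding B_def using unitary_conj_mult[OF U' A aA] lam by simp
  \<comment> \<open>In the new basis \<open>A = A * A * W\<close> reads \<open>B = B * Y\<close>.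
    Being a left multiple by \<open>B\<close>, the factor \<open>Y\<close> inherits lower rows
    without standard part.\<close>
  define Y where "Y = B * (adj U * W * U)"
  have W': "adj U * W * U \<in> carrier_mat n n"
    by (rule mult_carrier_mat[OF mult_carrier_mat[OF u(2) W] u(1)])
  have Y: "Y \<in> carrier_mat n n" unfolding Y_def by (rule mult_carrier_mat[OF B W'])
  have "Y = adj U * (A * W) * U"
    unfolding Y_def B_def using unitary_conj_mult[OF U' A W] by simp
  then have BY: "B * Y = B"
    unfolding B_def using unitary_conj_mult[OF U' A mult_carrier_mat[OF A W]] AW
      assoc_mult_mat[OF A A W] by simp
  have BBs: "(\<Sum>k<n. B $$ (i,k) * conjugate (B $$ (j,k))) =
      (if i = j then dual_complex_of_dual (lam i) else 0)" if ij: "i < n" "j < n" for i j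
  proof -
    have "(\<Sum>k<n. B $$ (i,k) * conjugate (B $$ (j,k))) = (\<Sum>k<n. B $$ (i,k) * adj B $$ (k,j))"
      using B ij by (intro sum.cong refl) simp
    also have "\<dots> = (B * adj B) $$ (i,j)" by (rule index_mult_mat_sum[OF B aB ij, symmetric])
    finally show ?thesis unfolding BB dual_diag_index[OF ij] .
  qed
  \<comment> \<open>The standard part of \<open>lam i\<close> is the squared norm of the standard
    part of row \<open>i\<close>, so this part of the row vanishes as soon as \<open>lam i\<close>
    has nonpositive standard part.\<close>
  have sq: "complex_of_real (std_part (lam i)) = complex_of_real (\<Sum>k<n. (cmod (std_part (B $$ (i,k))))\<^sup>2)"
    if "i < n" for i
    using arg_cong[OF BBs[OF that that], of std_part] by (simp add: complex_norm_square[symmetric])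
  define r where "r = (LEAST i. n \<le> i \<or> std_part (lam i) \<le> 0)"
  have rn: "r \<le> n" unfolding r_def by (rule Least_le) simp
  have pos: "0 < std_part (lam i)" if "i < r" for i
    using not_less_Least[OF that[unfolded r_def]] by simp
  have Bz: "std_part (B $$ (i,k)) = 0" if ri: "r \<le> i" "i < n" and k: "k < n" for i k
  proof -
    have "n \<le> r \<or> std_part (lam r) \<le> 0" unfolding r_def by (rule LeastI[of _ n]) simp
    then have "std_part (lam r) \<le> 0" using ri by auto
    moreover have "lam i \<le> lam r" using sorted ri by blast
    ultimately have "std_part (lam i) \<le> 0" by (auto simp: less_eq_dual_def)
    then have "(\<Sum>k<n. (cmod (std_part (B $$ (i,k))))\<^sup>2) \<le> 0" using sq[OF ri(2)] of_real_eq_iff by metis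
    then have "(\<Sum>k<n. (cmod (std_part (B $$ (i,k))))\<^sup>2) = 0" by (simp add: sum_nonneg antisym)
    then show ?thesis using k by (simp add: sum_nonneg_eq_0_iff)
  qed
  \<comment> \<open>First-order expansions of the square root of \<open>lam i\<close> and of its
    reciprocal \<open>\<nu> i\<close>; they are used only where the standard part is
    positive.\<close>
  define \<mu> where "\<mu> i = Dual (sqrt (std_part (lam i))) (inf_part (lam i) / (2 * sqrt (std_part (lam i))))" for i
  define \<nu> where "\<nu> i = Dual (1 / sqrt (std_part (lam i)))
    (- inf_part (lam i) / (2 * sqrt (std_part (lam i)) * std_part (lam i)))" for i
  have \<mu>2: "\<mu> i * \<mu> i = lam i" if "i < r" for i
    using pos[OF that] by (simp add: \<mu>_def dual_eq_iff field_simps)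
  have \<mu>\<nu>: "\<mu> i * \<nu> i = 1" if "i < r" for i
    using pos[OF that] by (simp add: \<mu>_def \<nu>_def dual_eq_iff field_simps)
  let ?m = "\<lambda>i. dual_complex_of_dual (\<mu> i)" and ?v = "\<lambda>i. dual_complex_of_dual (\<nu> i)"
  have mv: "?m i * ?v i = 1" if "i < r" for i
    using \<mu>\<nu>[OF that] by (metis dual_complex_of_dual_simps(1,3))
  have cv: "conjugate (?v i) = ?v i" for i by (simp add: dual_eq_iff)
  define N where "N = mat r n (\<lambda>(i,k). ?v i * B $$ (i,k))"
  have N: "N \<in> carrier_mat r n" unfolding N_def by simp
  have NB: "B $$ (i,k) = ?m i * N $$ (i,k)" if "i < r" "k < n" for i k
    using that mv[OF that(1)] by (simp add: N_def mult.assoc[symmetric])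
  have NN: "N * adj N = 1\<^sub>m r"
  proof (rule eq_matI)
    fix i j assume "i < dim_row (1\<^sub>m r :: complex dual mat)" "j < dim_col (1\<^sub>m r :: complex dual mat)"
    then have ij: "i < r" "j < r" by auto
    have "(N * adj N) $$ (i,j) = (\<Sum>k<n. N $$ (i,k) * adj N $$ (k,j))"
      by (rule index_mult_mat_sum[OF N adj_carrier[OF N] ij])
    also have "\<dots> = (\<Sum>k<n. ?v i * ?v j * (B $$ (i,k) * conjugate (B $$ (j,k))))"
      using ij by (intro sum.cong refl) (simp add: N_def conjugate_dist_mul cv mult_ac)
    also have "\<dots> = ?v i * ?v j * (if i = j then dual_complex_of_dual (lam i) else 0)"
      unfolding sum_distrib_left[symmetric] using BBs[of i j] ij rn by simp
    also have "\<dots> = 1\<^sub>m r $$ (i,j)"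
    proof (cases "i = j")
      case True
      have "?v i * ?v i * dual_complex_of_dual (lam i) = (?m i * ?v i) * (?m i * ?v i)"
        unfolding \<mu>2[OF ij(1), symmetric] dual_complex_of_dual_simps by (simp only: mult_ac)
      then show ?thesis using True ij mv[OF ij(1)] by simp
    qed (use ij in simp)
    finally show "(N * adj N) $$ (i,j) = 1\<^sub>m r $$ (i,j)" .
  qed (use N in auto)
  have Yz: "std_part (Y $$ (k,j)) = 0" if k: "r \<le> k" "k < n" and j: "j < n" for k j
    unfolding Y_def index_mult_mat_sum[OF B W' k(2) j] using Bz[OF k] by simp
  define Y1 where "Y1 = mat r n (\<lambda>(k,j). std_part (Y $$ (k,j)))"
  have Y1: "Y1 \<in> carrier_mat r n" unfolding Y1_def by simp
  define K1 where "K1 = mat r r (\<lambda>(i,j). std_part (N $$ (i,j)))"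
  have K1: "K1 \<in> carrier_mat r r" unfolding K1_def by simp
  have restrict: "(\<Sum>k<n. f k * std_part (Y $$ (k,j))) = (\<Sum>k<r. f k * Y1 $$ (k,j))"
    if "j < n" for f j
  proof -
    have "(\<Sum>k<n. f k * std_part (Y $$ (k,j))) = (\<Sum>k<r. f k * std_part (Y $$ (k,j)))"
      using rn Yz that by (intro sum.mono_neutral_right) auto
    then show ?thesis using that by (simp add: Y1_def)
  qed
  have BYs: "B $$ (i,j) = (\<Sum>k<n. B $$ (i,k) * Y $$ (k,j))" if "i < n" "j < n" for i j
    using index_mult_mat_sum[OF B Y that] unfolding BY .
  have Ns: "std_mat N \<in> carrier_mat r n" using N by simp
  note aNs = adj_carrier[OF Ns]
  have NNs: "std_mat N * adj (std_mat N) = 1\<^sub>m r"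
    using arg_cong[OF NN, of std_mat] std_mat_mult[OF N adj_carrier[OF N]] by (simp add: parts_adj)
  \<comment> \<open>In the standard part of \<open>B * Y = B\<close> only the first \<open>r\<close>
    rows of \<open>Y\<close> survive, so only the leading square block \<open>K1\<close> of
    \<open>N\<close> takes part.\<close>
  have NKY: "std_mat N = K1 * Y1"
  proof (rule eq_matI)
    fix i j assume "i < dim_row (K1 * Y1)" "j < dim_col (K1 * Y1)"
    then have i: "i < r" and j: "j < n" using K1 Y1 by auto
    have "std_part (N $$ (i,j)) = std_part (?v i) * std_part (B $$ (i,j))"
      using i j by (simp add: N_def)
    also have "\<dots> = (\<Sum>k<n. std_part (N $$ (i,k)) * std_part (Y $$ (k,j)))"
      using BYs[of i j] i j rn by (simp add: sum_distrib_left N_def mult.assoc)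
    also have "\<dots> = (\<Sum>k<r. K1 $$ (i,k) * Y1 $$ (k,j))"
      unfolding restrict[OF j] using i by (intro sum.cong refl) (simp add: K1_def)
    also have "\<dots> = (K1 * Y1) $$ (i,j)" by (rule index_mult_mat_sum[OF K1 Y1 i j, symmetric])
    finally show "std_mat N $$ (i,j) = (K1 * Y1) $$ (i,j)" using N i j by simp
  qed (use N K1 Y1 in auto)
  \<comment> \<open>Multiplying \<open>std_mat N = K1 * Y1\<close> on the right by the adjoint of
    \<open>std_mat N\<close> gives 1 on the left, which exhibits a right inverse of
    \<open>K1\<close>.\<close>
  define J where "J = Y1 * adj (std_mat N)"
  have J: "J \<in> carrier_mat r r" unfolding J_def by (rule mult_carrier_mat[OF Y1 aNs])
  have KJ: "K1 * J = 1\<^sub>m r"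
    unfolding J_def assoc_mult_mat[OF K1 Y1 aNs, symmetric] NKY[symmetric] by (rule NNs)
  have JK: "J * K1 = 1\<^sub>m r" by (rule mat_mult_left_right_inverse[OF K1 J KJ])
  \<comment> \<open>Let \<open>c\<close> be the infinitesimal part of such a row and
    \<open>c1\<close> its first \<open>r\<close> entries. Then \<open>B * Y = B\<close> gives
    \<open>c = c1 * Y1\<close>, and orthogonality to the upper rows gives \<open>c1 * J = 0\<close>.
    As \<open>J\<close> is invertible, \<open>c1\<close> and with it \<open>c\<close>
    vanish.\<close>
  have Bzero: "B $$ (i,j) = 0" if i: "r \<le> i" "i < n" and j: "j < n" for i j
  proof -
    define c where "c = mat 1 n (\<lambda>(_,k). inf_part (B $$ (i,k)))"
    have c: "c \<in> carrier_mat 1 n" unfolding c_def by simp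
    define c1 where "c1 = mat 1 r (\<lambda>(_,k). inf_part (B $$ (i,k)))"
    have c1: "c1 \<in> carrier_mat 1 r" unfolding c1_def by simp
    have ccY: "c = c1 * Y1"
    proof (rule eq_matI)
      fix l k assume "l < dim_row (c1 * Y1)" "k < dim_col (c1 * Y1)"
      then have l: "l < 1" and k: "k < n" using c1 Y1 by auto
      have "inf_part (B $$ (i,k)) = (\<Sum>m<n. inf_part (B $$ (i,m)) * std_part (Y $$ (m,k)))"
        using arg_cong[OF BYs[OF i(2) k], of inf_part] Bz[OF i] by simp
      also have "\<dots> = (\<Sum>m<r. c1 $$ (l,m) * Y1 $$ (m,k))"
        unfolding restrict[OF k] using l by (intro sum.cong refl) (simp add: c1_def)
      also have "\<dots> = (c1 * Y1) $$ (l,k)" by (rule index_mult_mat_sum[OF c1 Y1 l k, symmetric])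
      finally show "c $$ (l,k) = (c1 * Y1) $$ (l,k)" using l k by (simp add: c_def)
    qed (use c c1 Y1 in auto)
    have "c * adj (std_mat N) = 0\<^sub>m 1 r"
    proof (rule eq_matI)
      fix l k assume "l < dim_row (0\<^sub>m 1 r :: complex mat)" "k < dim_col (0\<^sub>m 1 r :: complex mat)"
      then have l: "l < 1" and k: "k < r" by auto
      have "(\<Sum>m<n. inf_part (B $$ (i,m)) * cnj (std_part (B $$ (k,m)))) = 0"
        using arg_cong[OF BBs[of i k], of inf_part] Bz[OF i] i k rn by simp
      then have "std_part (?v k) * (\<Sum>m<n. inf_part (B $$ (i,m)) * cnj (std_part (B $$ (k,m)))) = 0"
        by simp
      then have "(\<Sum>m<n. c $$ (l,m) * adj (std_mat N) $$ (m,k)) = 0"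
        using l k N by (simp add: sum_distrib_left c_def N_def mult_ac)
      then show "(c * adj (std_mat N)) $$ (l,k) = 0\<^sub>m 1 r $$ (l,k)"
        unfolding index_mult_mat_sum[OF c aNs l k] using l k by simp
    qed (use c Ns in auto)
    then have "c1 * J = 0\<^sub>m 1 r"
      unfolding ccY J_def assoc_mult_mat[OF c1 Y1 aNs] .
    then have "c1 * J * K1 = 0\<^sub>m 1 r" using K1 by simp
    then have "c1 = 0\<^sub>m 1 r"
      unfolding assoc_mult_mat[OF c1 J K1] JK right_mult_one_mat[OF c1] .
    then have "c = 0\<^sub>m 1 n" unfolding ccY using Y1 by simp
    then have "c $$ (0,j) = 0" using j by simp
    then show ?thesis using Bz[OF i j] j by (simp add: c_def dual_eq_iff)
  qed
  have "0 < \<mu> i \<and> appreciable (\<mu> i)" if "i < r" for i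
    using pos[OF that] by (simp add: \<mu>_def appreciable_def less_dual_def less_eq_dual_def)
  moreover have "\<mu> j \<le> \<mu> i" if ij: "i \<le> j" "j < r" for i j
  proof -
    have "lam j \<le> lam i" using sorted ij rn by auto
    moreover have "0 < std_part (lam j)" "0 < std_part (lam i)" using pos ij by auto
    ultimately show ?thesis by (auto simp: \<mu>_def less_eq_dual_def divide_right_mono)
  qed
  moreover have "B $$ (i,j) = (if i < r then ?m i * N $$ (i,j) else 0)" if "i < n" "j < n" for i j
    using that NB Bzero by auto
  ultimately show ?thesis
    using rn U N NN J KJ unfolding K1_def B_def
    by (intro exI[of _ U] exI[of _ r] exI[of _ \<mu>] exI[of _ N] exI[of _ J] conjI allI impI) auto
qed

section \<open>The group inverse\<close>

lemma top_blocks_mult: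
  fixes X Y X' Y' :: "'a::semiring_1 mat"
  assumes X: "X \<in> carrier_mat r r" and Y: "Y \<in> carrier_mat r (n - r)"
    and X': "X' \<in> carrier_mat r r" and Y': "Y' \<in> carrier_mat r (n - r)"
  shows "top_blocks n X Y * top_blocks n X' Y' = top_blocks n (X * X') (X * Y')"
proof -
  have t: "top_blocks n P Q = four_block_mat P Q (0\<^sub>m (n - r) r) (0\<^sub>m (n - r) (n - r))"
    if "P \<in> carrier_mat r r" "Q \<in> carrier_mat r (n - r)" for P Q :: "'a mat"
    unfolding top_blocks_def using that by simp
  have z: "Y * 0\<^sub>m (n - r) r = 0\<^sub>m r r" "Y * 0\<^sub>m (n - r) (n - r) = 0\<^sub>m r (n - r)"
    "0\<^sub>m (n - r) r * X' = 0\<^sub>m (n - r) r" "0\<^sub>m (n - r) r * Y' = 0\<^sub>m (n - r) (n - r)"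
    using Y X' Y' by simp_all
  show ?thesis
    unfolding t[OF X Y] t[OF X' Y'] t[OF mult_carrier_mat[OF X X'] mult_carrier_mat[OF X Y']]
      mult_four_block_mat[OF X Y zero_carrier_mat zero_carrier_mat X' Y' zero_carrier_mat zero_carrier_mat]
      z right_add_zero_mat[OF mult_carrier_mat[OF X X']] right_add_zero_mat[OF mult_carrier_mat[OF X Y']]
    by simp
qed

text \<open>Both products collapse to the block row with entries 1 and \<open>Ki * L\<close>, which
  is a left identity for every matrix whose lower rows are zero.\<close>

lemma is_DGGI_top_blocks:
  fixes S K Si Ki L :: "complex dual mat"
  assumes rn: "r \<le> n" and S: "S \<in> carrier_mat r r" and K: "K \<in> carrier_mat r r"
    and Si: "Si \<in> carrier_mat r r" and Ki: "Ki \<in> carrier_mat r r" and L: "L \<in> carrier_mat r (n - r)"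
    and SSi: "S * Si = 1\<^sub>m r" "Si * S = 1\<^sub>m r" and KKi: "K * Ki = 1\<^sub>m r" "Ki * K = 1\<^sub>m r"
  shows "is_DGGI (top_blocks n (S * K) (S * L)) (top_blocks n (Ki * Si) (Ki * Si * Ki * L))"
    (is "is_DGGI ?B ?X")
proof -
  note SK = mult_carrier_mat[OF S K] and SL = mult_carrier_mat[OF S L]
    and KiSi = mult_carrier_mat[OF Ki Si] and KiL = mult_carrier_mat[OF Ki L]
  have KSKL: "Ki * Si * Ki * L \<in> carrier_mat r (n - r)"
    by (rule mult_carrier_mat[OF mult_carrier_mat[OF KiSi Ki] L])
  have inv: "S * K * (Ki * Si) = 1\<^sub>m r" "Ki * Si * (S * K) = 1\<^sub>m r"
    unfolding mult_cancel_middle[OF S K Ki Si KKi(1)] mult_cancel_middle[OF Ki Si S K SSi(2)]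
    by (rule SSi KKi)+
  have "S * K * (Ki * Si * Ki * L) = S * K * (Ki * Si) * (Ki * L)"
    unfolding assoc_mult_mat[OF KiSi Ki L] by (rule assoc_mult_mat[OF SK KiSi KiL, symmetric])
  then have BX: "?B * ?X = top_blocks n (1\<^sub>m r) (Ki * L)"
    unfolding top_blocks_mult[OF SK SL KiSi KSKL] inv left_mult_one_mat[OF KiL] by simp
  have XB: "?X * ?B = top_blocks n (1\<^sub>m r) (Ki * L)"
    unfolding top_blocks_mult[OF KiSi KSKL SK SL] inv mult_cancel_middle[OF Ki Si S L SSi(2)] ..
  have "?B * ?X * ?B = ?B"
    unfolding BX top_blocks_mult[OF one_carrier_mat KiL SK SL]
      left_mult_one_mat[OF SK] left_mult_one_mat[OF SL] ..
  moreover have "?X * ?B * ?X = ?X"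
    unfolding XB top_blocks_mult[OF one_carrier_mat KiL KiSi KSKL]
      left_mult_one_mat[OF KiSi] left_mult_one_mat[OF KSKL] ..
  ultimately show ?thesis
    unfolding is_DGGI_def using BX XB top_blocks_carrier[OF SK SL rn] top_blocks_carrier[OF KiSi KSKL rn]
    by simp
qed

lemma is_DGGI_unitary_conj:
  assumes U: "is_unitary n U" and B: "B \<in> carrier_mat n n" and X: "is_DGGI B X"
  shows "is_DGGI (U * B * adj U) (U * X * adj U)"
proof -
  note u = is_unitaryD[OF U]
  have Xc: "X \<in> carrier_mat n n" and x: "B * X * B = B" "X * B * X = X" "B * X = X * B"
    using X B by (auto simp: is_DGGI_def)
  have "(U * B * adj U) * (U * X * adj U) * (U * B * adj U) = U * (B * X * B) * adj U"
    unfolding unitary_conj_mult[OF U B Xc] unitary_conj_mult[OF U mult_carrier_mat[OF B Xc] B] ..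
  moreover have "(U * X * adj U) * (U * B * adj U) * (U * X * adj U) = U * (X * B * X) * adj U"
    unfolding unitary_conj_mult[OF U Xc B] unitary_conj_mult[OF U mult_carrier_mat[OF Xc B] Xc] ..
  moreover have "(U * B * adj U) * (U * X * adj U) = (U * X * adj U) * (U * B * adj U)"
    unfolding unitary_conj_mult[OF U B Xc] unitary_conj_mult[OF U Xc B] x(3) ..
  moreover have "dim_row (U * B * adj U) = n" using u by simp
  moreover have "U * X * adj U \<in> carrier_mat n n"
    by (rule mult_carrier_mat[OF mult_carrier_mat[OF u(1) Xc] u(2)])
  ultimately show ?thesis unfolding is_DGGI_def x(1,2) by simp
qed

section \<open>Standard and infinitesimal parts of block rows\<close>

lemma parts_simps:
  fixes A B :: "complex dual mat"
  assumes "A \<in> carrier_mat n m" "B \<in> carrier_mat n m"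
  shows "std_mat (A + B) = std_mat A + std_mat B" "inf_mat (A + B) = inf_mat A + inf_mat B"
    "std_mat (- A) = - std_mat A" "inf_mat (- A) = - inf_mat A"
    "std_mat (eps \<cdot>\<^sub>m A) = 0\<^sub>m n m" "inf_mat (eps \<cdot>\<^sub>m A) = std_mat A"
  using assms by (auto intro!: eq_matI)

lemma lift_mat_parts:
  assumes "X \<in> carrier_mat n m"
  shows "std_mat (lift_mat X) = X" "inf_mat (lift_mat X) = 0\<^sub>m n m"
  using assms by (auto intro!: eq_matI)

lemma top_blocks_parts:
  assumes X: "X \<in> carrier_mat r r" and Y: "Y \<in> carrier_mat r (n - r)" and rn: "r \<le> n"
  shows "std_mat (top_blocks n X Y) = top_blocks n (std_mat X) (std_mat Y)"
    "inf_mat (top_blocks n X Y) = top_blocks n (inf_mat X) (inf_mat Y)"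
proof -
  note c = top_blocks_carrier[OF X Y rn] and i = top_blocks_index[OF X Y _ _ rn]
    and cs = top_blocks_carrier[OF parts_carrier(1)[OF X] parts_carrier(1)[OF Y] rn]
    and si = top_blocks_index[OF parts_carrier(1)[OF X] parts_carrier(1)[OF Y] _ _ rn]
    and ci = top_blocks_carrier[OF parts_carrier(2)[OF X] parts_carrier(2)[OF Y] rn]
    and ii = top_blocks_index[OF parts_carrier(2)[OF X] parts_carrier(2)[OF Y] _ _ rn]
  show "std_mat (top_blocks n X Y) = top_blocks n (std_mat X) (std_mat Y)"
    using carrier_matD[OF c] carrier_matD[OF cs] carrier_matD[OF X] carrier_matD[OF Y]
    by (intro eq_matI) (auto simp: i si)
  show "inf_mat (top_blocks n X Y) = top_blocks n (inf_mat X) (inf_mat Y)"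
    using carrier_matD[OF c] carrier_matD[OF ci] carrier_matD[OF X] carrier_matD[OF Y]
    by (intro eq_matI) (auto simp: i ii)
qed

lemma top_blocks_add:
  fixes X Y X' Y' :: "'a::monoid_add mat"
  assumes "X \<in> carrier_mat r r" "Y \<in> carrier_mat r (n - r)"
    "X' \<in> carrier_mat r r" "Y' \<in> carrier_mat r (n - r)" "r \<le> n"
  shows "top_blocks n X Y + top_blocks n X' Y' = top_blocks n (X + X') (Y + Y')"
proof -
  have t: "top_blocks n P Q = four_block_mat P Q (0\<^sub>m (n - r) r) (0\<^sub>m (n - r) (n - r))"
    if "P \<in> carrier_mat r r" "Q \<in> carrier_mat r (n - r)" for P Q :: "'a mat"
    unfolding top_blocks_def using that by simp
  show ?thesis
    unfolding t[OF assms(1,2)] t[OF assms(3,4)] t[OF add_carrier_mat[OF assms(3)] add_carrier_mat[OF assms(4)]]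
      add_four_block_mat[OF assms(1,2) zero_carrier_mat zero_carrier_mat assms(3,4) zero_carrier_mat zero_carrier_mat]
    by simp
qed

text \<open>The left side is the product rule for the infinitesimal part of
  \<open>Ki * Si * Ki * L\<close>, where \<open>Ki\<close> is \<open>J\<close> - eps
  \<open>J * K * J\<close> and \<open>Si\<close> is \<open>T\<close> - eps \<open>E\<close>; the
  right side is the shape of \<open>R\<close>.\<close>

lemma group_inverse_inf_identity:
  fixes J K T E L1 L2 :: "'a::comm_ring_1 mat"
  assumes J: "J \<in> carrier_mat r r" and K: "K \<in> carrier_mat r r" and T: "T \<in> carrier_mat r r"
    and E: "E \<in> carrier_mat r r" and L1: "L1 \<in> carrier_mat r m" and L2: "L2 \<in> carrier_mat r m"
  shows "J * T * J * L2 + (J * T * (- (J * K * J)) + (J * (- E) + - (J * K * J) * T) * J) * L1 =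
    J * T * J * L2 - J * (T * J * K + K * J * T) * J * L1 - J * E * J * L1"
proof -
  note mc = mult_carrier_mat[of _ r r _ r]
  define p where "p = J * (T * J * K) * J"
  define s where "s = J * (K * J * T) * J"
  define q where "q = J * E * J"
  have c: "p \<in> carrier_mat r r" "s \<in> carrier_mat r r" "q \<in> carrier_mat r r"
    unfolding p_def s_def q_def by (intro mc J K T E)+
  have JKJ: "J * K * J \<in> carrier_mat r r" by (intro mc J K)
  have 1: "J * T * (- (J * K * J)) = - p"
    unfolding p_def using J K T JKJ
    by (simp add: mc assoc_mult_mat[of _ r r _ r _ r])
  have 2: "(J * (- E) + - (J * K * J) * T) * J = - q + - s"
  proof -
    have "J * (- E) = - (J * E)" "- (J * K * J) * T = - (J * (K * J * T))"
      using J K T E by (simp_all add: mc assoc_mult_mat[of _ r r _ r _ r])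
    moreover have "(- (J * E) + - (J * (K * J * T))) * J = - (J * E) * J + - (J * (K * J * T)) * J"
      by (rule add_mult_distrib_mat[of _ r r _ _ r]) (use J K T E in \<open>simp_all add: mc\<close>)
    ultimately show ?thesis
      unfolding q_def s_def using J K T E by (simp add: mc)
  qed
  have 3: "J * (T * J * K + K * J * T) * J = p + s"
  proof -
    have "J * (T * J * K + K * J * T) = J * (T * J * K) + J * (K * J * T)"
      by (rule mult_add_distrib_mat[of _ r r _ r]) (intro mc J K T)+
    then show ?thesis
      unfolding p_def s_def
      using add_mult_distrib_mat[OF mc[OF J mc[OF mc[OF T J] K]] mc[OF J mc[OF mc[OF K J] T]] J] by simp
  qed
  have 4: "(- p + (- q + - s)) * L1 = - (p * L1) + (- (q * L1) + - (s * L1))"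
    using c L1 by (simp add: add_mult_distrib_mat[of _ r r _ _ m])
  have 5: "(p + s) * L1 = p * L1 + s * L1" by (rule add_mult_distrib_mat[OF c(1,2) L1])
  have JL: "J * T * J * L2 \<in> carrier_mat r m" by (rule mult_carrier_mat[OF mc[OF mc[OF J T] J] L2])
  note pL = mult_carrier_mat[OF c(1) L1] and sL = mult_carrier_mat[OF c(2) L1]
    and qL = mult_carrier_mat[OF c(3) L1]
  have "X + (- P + (- Q + - S)) = X - (P + S) - Q"
    if "X \<in> carrier_mat r m" "P \<in> carrier_mat r m" "Q \<in> carrier_mat r m" "S \<in> carrier_mat r m"
    for X P Q S :: "'a mat"
    using that by (intro eq_matI) auto
  from this[OF JL pL qL sL] show ?thesis
    unfolding 1 2 3 4 5 q_def[symmetric] .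
qed

theorem theorem4p9:
  fixes A :: "complex dual mat" and n r :: nat
  assumes "A \<in> dual_CM n" and "r = dual_rank A"
  shows "\<exists>U K1 K2 L1 L2 \<mu>.
    U \<in> dual_unitary n \<and>
    K1 \<in> carrier_mat r r \<and> K2 \<in> carrier_mat r r \<and> invertible_mat K1 \<and>
    L1 \<in> carrier_mat r (n - r) \<and> L2 \<in> carrier_mat r (n - r) \<and>
    K1 * mat_adjoint K1 + L1 * mat_adjoint L1 = 1\<^sub>m r \<and>
    K1 * mat_adjoint K2 + K2 * mat_adjoint K1 + L1 * mat_adjoint L2 + L2 * mat_adjoint L1
      = 0\<^sub>m r r \<and>
    (\<forall>i<r. 0 < \<mu> i \<and> appreciable (\<mu> i)) \<and>
    (\<forall>i j. i \<le> j \<and> j < r \<longrightarrow> \<mu> j \<le> \<mu> i) \<and>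
    (let S1 = dual_diag r \<mu>; S1s = std_mat S1; S1d = inf_mat S1;
         J = mat_inv K1; T = mat_inv S1s;
         R = J * T * J * L2 - J * (T * J * K2 + K2 * J * T) * J * L1 - J * (T ^\<^sub>m 2) * S1d * J * L1
     in A = U * top_blocks n (S1 * dual_mat K1 K2) (S1 * dual_mat L1 L2) * dual_adjoint U \<and>
        DGGI A = U *
          (top_blocks n (lift_mat J * mat_inv S1) (lift_mat J * mat_inv S1 * lift_mat J * lift_mat L1)
           + eps \<cdot>\<^sub>m top_blocks n
               (- (lift_mat J * lift_mat K2 * lift_mat J * mat_inv S1))
               (lift_mat (R + J * (T ^\<^sub>m 2) * S1d * J * L1)))
          * dual_adjoint U \<and>
        DGGI A = U *
          dual_mat
            (top_blocks n (J * T) (J * T * J * L1))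
            (top_blocks n (- (J * K2 * J * T) - J * (T ^\<^sub>m 2) * S1d) R)
          * dual_adjoint U)"
proof -
  note A = dual_CM_factor(1)[OF assms(1)]
  \<comment> \<open>The number \<open>k\<close> of appreciable rows is identified with
    \<open>r\<close> only in \<open>rk\<close>, once a group inverse and a singular value
    decomposition are available.\<close>
  obtain U k \<mu> N J where kn: "k \<le> n" and U: "is_unitary n U" and N: "N \<in> carrier_mat k n"
    and NN: "N * adj N = 1\<^sub>m k" and pos: "\<forall>i<k. 0 < \<mu> i \<and> appreciable (\<mu> i)"
    and sorted: "\<forall>i j. i \<le> j \<and> j < k \<longrightarrow> \<mu> j \<le> \<mu> i" and J: "J \<in> carrier_mat k k"
    and KJ': "mat k k (\<lambda>(i,j). std_part (N $$ (i,j))) * J = 1\<^sub>m k"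
    and UAU: "\<forall>i<n. \<forall>j<n. (adj U * A * U) $$ (i,j) =
      (if i < k then dual_complex_of_dual (\<mu> i) * N $$ (i,j) else 0)"
    using dual_CM_unitary_rows[OF assms(1)] by (elim exE conjE) (rule that)
  note u = is_unitaryD[OF U]
  define K where "K = mat k k (\<lambda>(i,j). N $$ (i,j))"
  define L where "L = mat k (n - k) (\<lambda>(i,j). N $$ (i, j + k))"
  have K: "K \<in> carrier_mat k k" and L: "L \<in> carrier_mat k (n - k)"
    unfolding K_def L_def by simp_all
  define S where "S = dual_diag k \<mu>"
  have S: "S \<in> carrier_mat k k" unfolding S_def by simp
  note SK = mult_carrier_mat[OF S K] and SL = mult_carrier_mat[OF S L]
  define B where "B = adj U * A * U"
  have B: "B \<in> carrier_mat n n"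
    unfolding B_def by (rule mult_carrier_mat[OF mult_carrier_mat[OF u(2) A] u(1)])
  have AB: "A = U * B * adj U" by (rule unitary_similar_eq[OF U A B_def[symmetric]])
  have Bblocks: "B = top_blocks n (S * K) (S * L)"
  proof (rule eq_matI)
    note tc = top_blocks_carrier[OF SK SL kn]
    show "dim_row B = dim_row (top_blocks n (S * K) (S * L))"
      "dim_col B = dim_col (top_blocks n (S * K) (S * L))"
      using carrier_matD[OF tc] B by simp_all
    fix i j assume "i < dim_row (top_blocks n (S * K) (S * L))" "j < dim_col (top_blocks n (S * K) (S * L))"
    then have ij: "i < n" "j < n" using carrier_matD[OF tc] by simp_all
    have "(S * K) $$ (i,j) = dual_complex_of_dual (\<mu> i) * N $$ (i,j)" if "i < k" "j < k"
      unfolding S_def dual_diag_def mat_diag_mult_left[OF K] using that by (simp add: K_def)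
    moreover have "(S * L) $$ (i, j - k) = dual_complex_of_dual (\<mu> i) * N $$ (i,j)" if "i < k" "\<not> j < k"
      unfolding S_def dual_diag_def mat_diag_mult_left[OF L] using that ij by (simp add: L_def)
    ultimately show "B $$ (i,j) = top_blocks n (S * K) (S * L) $$ (i,j)"
      unfolding top_blocks_index[OF SK SL ij kn] using UAU ij unfolding B_def by simp
  qed
  define K1 where "K1 = std_mat K"
  define K2 where "K2 = inf_mat K"
  define L1 where "L1 = std_mat L"
  define L2 where "L2 = inf_mat L"
  have c: "K1 \<in> carrier_mat k k" "K2 \<in> carrier_mat k k" "L1 \<in> carrier_mat k (n - k)"
    "L2 \<in> carrier_mat k (n - k)"
    unfolding K1_def K2_def L1_def L2_def using K L by simp_all
  have KL: "K = dual_mat K1 K2" "L = dual_mat L1 L2"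
    unfolding K1_def K2_def L1_def L2_def dual_mat_of_parts by simp_all
  \<comment> \<open>This is \<open>N * adj N = 1\<close> with the columns split at \<open>k\<close>;
    its standard and infinitesimal parts are the two required relations between the blocks.\<close>
  have KKLL: "K * adj K + L * adj L = 1\<^sub>m k"
  proof (rule eq_matI)
    fix i j assume "i < dim_row (1\<^sub>m k :: complex dual mat)" "j < dim_col (1\<^sub>m k :: complex dual mat)"
    then have ij: "i < k" "j < k" by auto
    let ?f = "\<lambda>l. N $$ (i,l) * conjugate (N $$ (j,l))"
    have "(N * adj N) $$ (i,j) = (\<Sum>l<n. ?f l)"
      unfolding index_mult_mat_sum[OF N adj_carrier[OF N] ij] using N ij by (intro sum.cong) auto
    also have "\<dots> = (\<Sum>l<k. ?f l) + (\<Sum>l<n - k. ?f (l + k))"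
      by (rule sum_split_shift[OF kn])
    also have "(\<Sum>l<k. ?f l) = (K * adj K) $$ (i,j)"
      unfolding index_mult_mat_sum[OF K adj_carrier[OF K] ij] using ij by (intro sum.cong) (auto simp: K_def)
    also have "(\<Sum>l<n - k. ?f (l + k)) = (L * adj L) $$ (i,j)"
      unfolding index_mult_mat_sum[OF L adj_carrier[OF L] ij] using ij by (intro sum.cong) (auto simp: L_def)
    finally show "(K * adj K + L * adj L) $$ (i,j) = 1\<^sub>m k $$ (i,j)"
      unfolding NN using ij K L by simp
  qed (use K L in auto)
  note aK = adj_carrier[OF K] and aL = adj_carrier[OF L]
  note KK = mult_carrier_mat[OF K aK] and LL = mult_carrier_mat[OF L aL]
  have orth1: "K1 * adj K1 + L1 * adj L1 = 1\<^sub>m k"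
    using arg_cong[OF KKLL, of std_mat]
    unfolding parts_simps(1)[OF KK LL] std_mat_mult[OF K aK] std_mat_mult[OF L aL] parts_adj
      K1_def[symmetric] L1_def[symmetric] by simp
  have orth2: "K1 * adj K2 + K2 * adj K1 + L1 * adj L2 + L2 * adj L1 = 0\<^sub>m k k"
  proof -
    have "K1 * adj K2 + K2 * adj K1 + (L1 * adj L2 + L2 * adj L1) = 0\<^sub>m k k"
      using arg_cong[OF KKLL, of inf_mat]
      unfolding parts_simps(2)[OF KK LL] inf_mat_mult[OF K aK] inf_mat_mult[OF L aL] parts_adj
        K1_def[symmetric] L1_def[symmetric] K2_def[symmetric] L2_def[symmetric] by simp
    moreover have "L1 * adj L2 \<in> carrier_mat k k" "L2 * adj L1 \<in> carrier_mat k k"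
      "K1 * adj K2 + K2 * adj K1 \<in> carrier_mat k k"
      using mult_carrier_mat[OF c(3) adj_carrier[OF c(4)]] mult_carrier_mat[OF c(4) adj_carrier[OF c(3)]]
        mult_carrier_mat[OF c(2) adj_carrier[OF c(1)]] by (simp_all add: add_carrier_mat)
    ultimately show ?thesis by (simp add: assoc_add_mat[of _ k k])
  qed
  have "mat k k (\<lambda>(i,j). std_part (N $$ (i,j))) = K1"
    unfolding K1_def K_def by (rule eq_matI) auto
  with KJ' have KJ: "K1 * J = 1\<^sub>m k" by simp
  have JK: "J * K1 = 1\<^sub>m k" by (rule mat_mult_left_right_inverse[OF c(1) J KJ])
  have inv: "invertible_mat K1"
    unfolding invertible_mat_def inverts_mat_def using c(1) J KJ JK by auto
  have Jinv: "mat_inv K1 = J" by (rule mat_inv_eqI[OF c(1) J KJ JK])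
  note mc = mult_carrier_mat[of _ k k _ k]
  have JKJ: "J * K2 * J \<in> carrier_mat k k" by (intro mc J c(2))
  \<comment> \<open>First-order inverse of \<open>K1\<close> + eps \<open>K2\<close>. The matrix
    \<open>Si\<close> below is the same expansion for the diagonal entries, 1/(s + eps d) = 1/s -
    eps d/s^2.\<close>
  define Ki where "Ki = dual_mat J (- (J * K2 * J))"
  have Ki: "Ki \<in> carrier_mat k k" unfolding Ki_def using JKJ by (intro parts_carrier) simp
  have Kis: "std_mat Ki = J" and Kid: "inf_mat Ki = - (J * K2 * J)"
    unfolding Ki_def using J JKJ by (intro dual_mat_parts[of _ k k]; simp)+
  have KKi: "K * Ki = 1\<^sub>m k"
  proof (rule dual_mat_eqI[OF mult_carrier_mat[OF K Ki] one_carrier_mat])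
    show "std_mat (K * Ki) = std_mat (1\<^sub>m k)"
      unfolding std_mat_mult[OF K Ki] Kis K1_def[symmetric] KJ by simp
    have "K1 * (- (J * K2 * J)) = - (K1 * (J * (K2 * J)))"
      using c(1,2) J JKJ by (simp add: assoc_mult_mat[OF J c(2) J])
    also have "\<dots> = - (K2 * J)"
      unfolding assoc_mult_mat[OF c(1) J mc[OF c(2) J], symmetric] KJ left_mult_one_mat[OF mc[OF c(2) J]] ..
    finally have "inf_mat (K * Ki) = - (K2 * J) + K2 * J"
      unfolding inf_mat_mult[OF K Ki] Kis Kid K1_def[symmetric] K2_def[symmetric] by simp
    then show "inf_mat (K * Ki) = inf_mat (1\<^sub>m k)"
      using uminus_l_inv_mat[OF mc[OF c(2) J]] by simp
  qed
  have KiK: "Ki * K = 1\<^sub>m k" by (rule dual_left_right_inverse[OF K Ki KKi])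
  define s where "s i = complex_of_real (std_part (\<mu> i))" for i
  define d where "d i = complex_of_real (inf_part (\<mu> i))" for i
  have s0: "s i \<noteq> 0" if "i < k" for i using pos that by (simp add: s_def appreciable_def)
  define Si where "Si = mat_diag k (\<lambda>i. Dual (1 / s i) (- d i / (s i)\<^sup>2))"
  have Si: "Si \<in> carrier_mat k k" unfolding Si_def by simp
  have SSi: "S * Si = 1\<^sub>m k"
  proof -
    have "dual_complex_of_dual (\<mu> i) * Dual (1 / s i) (- d i / (s i)\<^sup>2) = 1" if "i < k" for i
      using s0[OF that] by (simp add: dual_eq_iff power2_eq_square s_def d_def)
    then show ?thesis
      unfolding S_def Si_def dual_diag_def mat_diag_diag by (intro eq_matI) (auto simp: mat_diag_def)
  qed
  have SiS: "Si * S = 1\<^sub>m k" by (rule dual_left_right_inverse[OF S Si SSi])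
  have Sinv: "mat_inv S = Si" by (rule mat_inv_eqI[OF S Si SSi SiS])
  define T where "T = std_mat Si"
  have T: "T \<in> carrier_mat k k" unfolding T_def using Si by simp
  have Tinv: "mat_inv (std_mat S) = T"
    by (rule mat_inv_eqI[OF parts_carrier(1)[OF S] T])
      (simp_all add: T_def std_mat_mult[OF S Si, symmetric] std_mat_mult[OF Si S, symmetric] SSi SiS)
  \<comment> \<open>All these matrices are diagonal, so \<open>E\<close> has entries d/s^2 and is
    minus the infinitesimal part of \<open>Si\<close>.\<close>
  define E where "E = (T ^\<^sub>m 2) * inf_mat S"
  have T2: "T ^\<^sub>m 2 = mat_diag k (\<lambda>i. 1 / (s i)\<^sup>2)"
  proof -
    have "T = mat_diag k (\<lambda>i. 1 / s i)"
      unfolding T_def Si_def by (rule eq_matI) (auto simp: mat_diag_def)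
    then show ?thesis using T by (simp add: numeral_2_eq_2 power2_eq_square)
  qed
  have Sd: "inf_mat S = mat_diag k d"
    unfolding S_def by (rule eq_matI) (auto simp: mat_diag_def dual_diag_index d_def)
  have E: "E \<in> carrier_mat k k" unfolding E_def T2 Sd by simp
  have Sid: "inf_mat Si = - E"
    unfolding E_def T2 Sd mat_diag_diag Si_def by (rule eq_matI) (auto simp: mat_diag_def)
  define X where "X = top_blocks n (Ki * Si) (Ki * Si * Ki * L)"
  have BX: "is_DGGI B X"
    unfolding Bblocks X_def by (rule is_DGGI_top_blocks[OF kn S K Si Ki L SSi SiS KKi KiK])
  have AX: "is_DGGI A (U * X * adj U)"
    using is_DGGI_unitary_conj[OF U B BX] unfolding AB[symmetric] .
  have DG: "DGGI A = U * X * adj U" by (rule DGGI_eqI[OF A AX])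
  \<comment> \<open>Since \<open>N * V\<close> consists of the first \<open>k\<close> coordinate
    rows, \<open>B * V\<close> is already the diagonal factor; hence \<open>U\<close> and
    \<open>U * V\<close> give a decomposition of \<open>A\<close> with the singular values
    \<open>\<mu>\<close>.\<close>
  obtain V where V: "is_unitary n V"
    and NV: "\<forall>i<k. \<forall>j<n. (N * V) $$ (i,j) = (if i = j then 1 else 0)"
    using orthonormal_rows_completion[OF N NN kn] by blast
  note v = is_unitaryD[OF V]
  let ?D = "top_blocks n S (0\<^sub>m k (n - k))"
  have D: "?D \<in> carrier_mat n n" by (rule top_blocks_carrier[OF S zero_carrier_mat kn])
  have BV: "B * V = ?D"
  proof (rule eq_matI)
    show "dim_row (B * V) = dim_row ?D" "dim_col (B * V) = dim_col ?D"
      using carrier_matD[OF D] B v(1) by simp_all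
    fix i j assume "i < dim_row ?D" "j < dim_col ?D"
    then have ij: "i < n" "j < n" using carrier_matD[OF D] by simp_all
    have "(B * V) $$ (i,j) = (\<Sum>l<n. B $$ (i,l) * V $$ (l,j))"
      by (rule index_mult_mat_sum[OF B v(1) ij])
    also have "\<dots> = (if i < k then dual_complex_of_dual (\<mu> i) * (N * V) $$ (i,j) else 0)"
      using UAU ij index_mult_mat_sum[OF N v(1) _ ij(2), of i] unfolding B_def[symmetric]
      by (simp add: sum_distrib_left mult.assoc)
    also have "\<dots> = ?D $$ (i,j)"
      unfolding top_blocks_index[OF S zero_carrier_mat ij kn]
      using NV ij kn by (auto simp: S_def dual_diag_index)
    finally show "(B * V) $$ (i,j) = ?D $$ (i,j)" .
  qed
  have "?D * adj V = B"
    unfolding BV[symmetric] assoc_mult_mat[OF B v(1,2)] v(4) by (rule right_mult_one_mat[OF B])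
  then have svd: "A = U * ?D * adj (U * V)"
    unfolding adj_mult[OF u(1) v(1)] assoc_mult_mat[OF mult_carrier_mat[OF u(1) D] v(2) u(2), symmetric]
      assoc_mult_mat[OF u(1) D v(2)] using AB by simp
  have "is_dual_svd A U k \<mu> (U * V)"
    unfolding is_dual_svd_def is_unitary_iff_dual_unitary dual_adjoint_eq_adj
      carrier_matD[OF A] S_def[symmetric]
    by (intro conjI U is_unitary_mult[OF U V] kn sorted svd) (use pos in blast)
  moreover have "U * X * adj U \<in> carrier_mat n n" "A * (U * X * adj U) * A = A"
    using AX A by (auto simp: is_DGGI_def)
  ultimately have rk: "r = k" using dual_rank_eqI[OF A] assms(2) by simp
  define T2 where "T2 = T ^\<^sub>m 2"
  define R where "R = J * T * J * L2 - J * (T * J * K2 + K2 * J * T) * J * L1 - J * T2 * inf_mat S * J * L1"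
  have JE: "J * T2 * inf_mat S = J * E"
    unfolding E_def T2_def using J T S by (intro assoc_mult_mat[of _ k k _ k _ k]) simp_all
  note KiSi = mult_carrier_mat[OF Ki Si]
  note KSK = mult_carrier_mat[OF KiSi Ki]
  note KSKL = mult_carrier_mat[OF KSK L]
  have JT: "J * T \<in> carrier_mat k k" by (rule mc[OF J T])
  have JTJL: "J * T * J * L1 \<in> carrier_mat k (n - k)" by (rule mult_carrier_mat[OF mc[OF JT J] c(3)])
  have JKJT: "J * K2 * J * T \<in> carrier_mat k k" by (intro mc J c(2) T)
  have JEc: "J * E \<in> carrier_mat k k" by (rule mc[OF J E])
  have JEJL: "J * E * J * L1 \<in> carrier_mat k (n - k)" by (rule mult_carrier_mat[OF mc[OF JEc J] c(3)])
  have mE: "- E \<in> carrier_mat k k" using E by simp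
  have std1: "std_mat (Ki * Si) = J * T"
    unfolding std_mat_mult[OF Ki Si] Kis T_def ..
  have inf1: "inf_mat (Ki * Si) = J * (- E) + - (J * K2 * J) * T"
    unfolding inf_mat_mult[OF Ki Si] Kis Kid Sid T_def ..
  have std2: "std_mat (Ki * Si * Ki * L) = J * T * J * L1"
    unfolding std_mat_mult[OF KSK L] std_mat_mult[OF KiSi Ki] std1 Kis L1_def ..
  have R: "R = J * T * J * L2 - J * (T * J * K2 + K2 * J * T) * J * L1 - J * E * J * L1"
    unfolding R_def JE ..
  have inf2: "inf_mat (Ki * Si * Ki * L) = R"
    unfolding inf_mat_mult[OF KSK L] inf_mat_mult[OF KiSi Ki] std_mat_mult[OF KiSi Ki] std1 inf1 Kis Kid
      L1_def[symmetric] L2_def[symmetric] R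
    by (rule group_inverse_inf_identity[OF J c(2) T E c(3,4)])
  have Rc: "R \<in> carrier_mat k (n - k)"
    unfolding inf2[symmetric] using parts_carrier(2)[OF KSKL] .
  have inf1': "inf_mat (Ki * Si) = - (J * K2 * J * T) - J * E"
  proof -
    have "J * (- E) = - (J * E)" "- (J * K2 * J) * T = - (J * K2 * J * T)"
      using J E JKJ T by simp_all
    then show ?thesis unfolding inf1 using neg_mat_add(1)[OF JEc JKJT] by simp
  qed
  have Xs: "std_mat X = top_blocks n (J * T) (J * T * J * L1)"
    unfolding X_def top_blocks_parts[OF KiSi KSKL kn] std1 std2 ..
  have Xi: "inf_mat X = top_blocks n (- (J * K2 * J * T) - J * T2 * inf_mat S) R"
    unfolding X_def top_blocks_parts[OF KiSi KSKL kn] inf1' inf2 JE ..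
  have X2: "X = dual_mat (top_blocks n (J * T) (J * T * J * L1))
      (top_blocks n (- (J * K2 * J * T) - J * T2 * inf_mat S) R)"
    unfolding Xs[symmetric] Xi[symmetric] by (rule dual_mat_of_parts[symmetric])
  \<comment> \<open>Here \<open>Si\<close> keeps its infinitesimal part, which already contributes
    \<open>- (J * E)\<close> to the left block and \<open>- (J * E * J * L1)\<close> to the right
    one. The term added to \<open>R\<close> compensates for the latter, and the left block of the
    second summand omits the former.\<close>
  have X1: "X = top_blocks n (lift_mat J * Si) (lift_mat J * Si * lift_mat J * lift_mat L1)
      + eps \<cdot>\<^sub>m top_blocks n (- (lift_mat J * lift_mat K2 * lift_mat J * Si))
          (lift_mat (R + J * T2 * inf_mat S * J * L1))" (is "X = ?P + eps \<cdot>\<^sub>m ?Q")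
  proof -
    note lJ = parts_carrier(3)[OF J] and lK = parts_carrier(3)[OF c(2)] and lL = parts_carrier(3)[OF c(3)]
    note lp = lift_mat_parts[OF J] lift_mat_parts[OF c(2)] lift_mat_parts[OF c(3)]
    note JS = mult_carrier_mat[OF lJ Si]
    note JSJ = mult_carrier_mat[OF JS lJ]
    note JSJL = mult_carrier_mat[OF JSJ lL]
    note JK2 = mult_carrier_mat[OF lJ lK]
    note JKJ2 = mult_carrier_mat[OF JK2 lJ]
    note JKJS = mult_carrier_mat[OF JKJ2 Si]
    have RE: "R + J * T2 * inf_mat S * J * L1 \<in> carrier_mat k (n - k)"
      unfolding JE using JEJL by simp
    have mJKJS: "- (lift_mat J * lift_mat K2 * lift_mat J * Si) \<in> carrier_mat k k" using JKJS by simp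
    note P = top_blocks_carrier[OF JS JSJL kn]
    note Q = top_blocks_carrier[OF mJKJS parts_carrier(3)[OF RE] kn]
    have eQ: "eps \<cdot>\<^sub>m ?Q \<in> carrier_mat n n" using Q by simp
    have Xc: "X \<in> carrier_mat n n" unfolding X_def by (rule top_blocks_carrier[OF KiSi KSKL kn])
    have s1: "std_mat (lift_mat J * Si) = J * T" unfolding std_mat_mult[OF lJ Si] lp T_def ..
    have s2: "std_mat (lift_mat J * Si * lift_mat J * lift_mat L1) = J * T * J * L1"
      unfolding std_mat_mult[OF JSJ lL] std_mat_mult[OF JS lJ] s1 lp ..
    have i1: "inf_mat (lift_mat J * Si) = - (J * E)"
      unfolding inf_mat_mult[OF lJ Si] lp Sid T_def[symmetric] using J E T JEc by simp
    have mJE: "- (J * E) \<in> carrier_mat k k" using JEc by simp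
    have i2: "inf_mat (lift_mat J * Si * lift_mat J * lift_mat L1) = - (J * E * J * L1)"
      unfolding inf_mat_mult[OF JSJ lL] inf_mat_mult[OF JS lJ] std_mat_mult[OF JS lJ] s1 i1 lp
        right_mult_zero_mat[OF JT] right_mult_zero_mat[OF mc[OF JT J]]
        left_add_zero_mat[OF mc[OF mJE J]] left_add_zero_mat[OF mult_carrier_mat[OF mc[OF mJE J] c(3)]]
      using JEc J E c(3) by simp
    have s3: "std_mat (- (lift_mat J * lift_mat K2 * lift_mat J * Si)) = - (J * K2 * J * T)"
      unfolding parts_simps(3)[OF JKJS JKJS] std_mat_mult[OF JKJ2 Si] std_mat_mult[OF JK2 lJ]
        std_mat_mult[OF lJ lK] lp T_def ..
    have "std_mat (?P + eps \<cdot>\<^sub>m ?Q) = std_mat X"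
      unfolding parts_simps(1)[OF P eQ] parts_simps(5)[OF Q Q] top_blocks_parts[OF JS JSJL kn] s1 s2
        Xs
      by (rule right_add_zero_mat[OF top_blocks_carrier[OF JT JTJL kn]])
    moreover have "inf_mat (?P + eps \<cdot>\<^sub>m ?Q) = inf_mat X"
    proof -
      have m: "- (J * K2 * J * T) \<in> carrier_mat k k" "- (J * E * J * L1) \<in> carrier_mat k (n - k)"
        using JKJT JEJL by simp_all
      have "inf_mat (?P + eps \<cdot>\<^sub>m ?Q) =
          top_blocks n (- (J * E) + - (J * K2 * J * T)) (- (J * E * J * L1) + (R + J * E * J * L1))"
        unfolding parts_simps(2)[OF P eQ] parts_simps(6)[OF Q Q] top_blocks_parts[OF JS JSJL kn] i1 i2
          top_blocks_parts[OF mJKJS parts_carrier(3)[OF RE] kn] s3 lift_mat_parts[OF RE]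
        unfolding JE by (rule top_blocks_add[OF mJE m(2) m(1) RE[unfolded JE] kn])
      also have "- (J * E) + - (J * K2 * J * T) = - (J * K2 * J * T) - J * E"
        by (rule neg_mat_add(1)[OF JEc JKJT])
      also have "- (J * E * J * L1) + (R + J * E * J * L1) = R"
        by (rule neg_mat_add(2)[OF JEJL Rc])
      finally show ?thesis unfolding Xi JE .
    qed
    ultimately show ?thesis using dual_mat_eqI[OF Xc, of "?P + eps \<cdot>\<^sub>m ?Q"] P eQ by simp
  qed
  have final: "A = U * top_blocks n (S * dual_mat K1 K2) (S * dual_mat L1 L2) * adj U"
    using AB unfolding Bblocks KL[symmetric] .
  show ?thesis
    unfolding is_unitary_iff_dual_unitary mat_adjoint_eq_adj dual_adjoint_eq_adj rk
    by (intro exI[of _ U] exI[of _ K1] exI[of _ K2] exI[of _ L1] exI[of _ L2] exI[of _ \<mu>] conjI U c inv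
        orth1 orth2 pos sorted)
      (unfold Let_def S_def[symmetric] Jinv Tinv Sinv T2_def[symmetric] R_def[symmetric],
        intro conjI final DG[unfolded X1] DG[unfolded X2])
qed

end
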